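(* Assume the following. (a) For every $i$: with probability $1$, $M_i(t_2,X_i)-M_i(t_1,X_i)=\int_{t_1}^{t_2}M_i'(t,X_i)\,dt$ for all intervals $(t_1,t_2)\subset\Theta$ (with endpoints in $\Theta$); moreover $\mathbf{E}M_i(\theta,X_i)=0$, $\mathbf{E}M_i^2(\theta,X_i)<\infty$, $\mathbf{E}|M_i'(\theta,X_i)|<\infty$. (b) For all sufficiently large $n$, $I_n>0$ and $J_n\neq 0$; moreover $|J_n|/\sqrt{I_n}\to\infty$, $\sum_{i=1}^n M_i'(\theta,X_i)/J_n\xrightarrow{p}1$ and $\sum_{i=1}^n M_i(\theta,X_i)/\sqrt{I_n}\Rightarrow\mathcal{N}(0,1)$. (c) $\lim_{\delta\to0}\limsup_{n\to\infty}\overline\tau_n(\delta)=0$. (d) The estimator $\theta_n^*=\theta_n^*(X_1,\dots,X_n)$ satisfies $\frac{|J_n|}{\sqrt{I_n}}|\theta_n^*-\theta|\,\overline\tau_n(|\theta_n^*-\theta|)\xrightarrow{p}0$. (e) There is a statistic $J_n^*$ such that, with $\overline{M_n'}(\theta):=\sum_{i=1}^nM_i'(\theta,X_i)/J_n-1$, $$\frac{|J_n|}{\sqrt{I_n}}|\theta_n^*-\theta|\Big(|J_n^*/J_n-1|+\big|\overline{M_n'}(\theta)\big|\Big)\xrightarrow{p}0,\qquad J_n^*/J_n\xrightarrow{p}1.$$ Then the one-step $M$-estimator $\theta_{n,J}^{**}=\theta_n^*-\sum_{i=1}^nM_i(\theta_n^*,X_i)/J_n^*$ is defined with probability tending to $1$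 and $$\frac{J_n}{\sqrt{I_n}}\big(\theta_{n,J}^{**}-\theta\big)\Rightarrow\mathcal{N}(0,1).$$ If in addition $\sum_{i=1}^n[M_i'(\theta,X_i)]^2/J_n^2\xrightarrow{p}0$ and $\sum_{i=1}^nM_i^2(\theta,X_i)/I_n\xrightarrow{p}1$, then the statistic $d_{n,J}^*=J_n^*\big/\big(\sum_{i=1}^nM_i^2(\theta_{n,J}^{**},X_i)\big)^{1/2}$ is defined with probability tending to $1$ and $$d_{n,J}^*\big(\theta_{n,J}^{**}-\theta\big)\Rightarrow\mathcal{N}(0,1).$$
   Context: All limits are as $n\to\infty$ unless stated otherwise; $\xrightarrow{p}$ is convergence in probability, $\Rightarrow$ is weak convergence of distributions. Setting: for each $n$ one observes independent elements $X_1,\dots,X_n$ of an arbitrary measurable space, not necessarily identically distributed. Their distributions depend on an unknown parameter belonging to an open set $\Theta\subset\mathbb{R}$, may also depend on $n$, and may depend on nuisance parameters. The symbol $\theta\in\Theta$ denotes the (fixed) true value, and $\mathbf{P},\mathbf{E}$ refer to the true distributions. For each $i$ there are given functions $M_i(t,X_i)$ and $M_i'(t,X_i)$ of $t\in\Theta$ (possibly depending on $n$). Notation: $I_n=\sum_{i=1}^n\mathbf{E}M_i^2(\theta,X_i)$, $J_n=\sum_{i=1}^n\mathbf{E}M_i'(\theta,X_i)$, $\overline\tau_n(\delta)=|J_n|^{-1}\sum_{i=1}^n\mathbf{E}\tau_i(\delta,X_i)$, where $\tau_i(\delta,X_i)=\sup_{t:|t-\theta|\le\delta}|M_i'(t,X_i)-M_i'(\theta,X_i)|$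 if $[\theta-\delta,\theta+\delta]\subset\Theta$ and $\tau_i(\delta,X_i)=\infty$ otherwise. In $\overline\tau_n(|\theta_n^*-\theta|)$ the deterministic function $\overline\tau_n$ is evaluated at the random point $|\theta_n^*-\theta|$. A statistic is "defined with probability tending to $1$" if the probability that all quantities in its definition are defined (arguments in $\Theta$, denominators nonzero) tends to $1$. *)

theory Defs
  imports "HOL-Probability.Probability"
begin

text \<open>
  A triangular array: for each sample size \<open>n\<close> the data \<open>X n 1, \<dots>, X n n\<close> live on a
  probability space \<open>P n\<close> (carrying the true distributions), and \<open>M n i t x\<close>,
  \<open>M' n i t x\<close> stand for \<open>M\<^sub>i(t, x)\<close> and \<open>M\<^sub>i'(t, x)\<close>, which may depend on \<open>n\<close>.  Row indices
  run over \<open>{1..n}\<close>.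
\<close>

definition I_sum ::
  "(nat \<Rightarrow> 'w measure) \<Rightarrow> (nat \<Rightarrow> nat \<Rightarrow> 'w \<Rightarrow> 'x) \<Rightarrow> (nat \<Rightarrow> nat \<Rightarrow> real \<Rightarrow> 'x \<Rightarrow> real) \<Rightarrow> real \<Rightarrow> nat \<Rightarrow> real"
  where "I_sum P X M \<theta> n = (\<Sum>i=1..n. \<integral>\<omega>. (M n i \<theta> (X n i \<omega>))\<^sup>2 \<partial>P n)"

definition J_sum ::
  "(nat \<Rightarrow> 'w measure) \<Rightarrow> (nat \<Rightarrow> nat \<Rightarrow> 'w \<Rightarrow> 'x) \<Rightarrow> (nat \<Rightarrow> nat \<Rightarrow> real \<Rightarrow> 'x \<Rightarrow> real) \<Rightarrow> real \<Rightarrow> nat \<Rightarrow> real"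
  where "J_sum P X M' \<theta> n = (\<Sum>i=1..n. \<integral>\<omega>. M' n i \<theta> (X n i \<omega>) \<partial>P n)"

definition tau :: "real set \<Rightarrow> (real \<Rightarrow> 'x \<Rightarrow> real) \<Rightarrow> real \<Rightarrow> real \<Rightarrow> 'x \<Rightarrow> ennreal"
  where "tau \<Theta> m' \<theta> \<delta> x =
    (if {\<theta> - \<delta>..\<theta> + \<delta>} \<subseteq> \<Theta> then (SUP t\<in>{t. \<bar>t - \<theta>\<bar> \<le> \<delta>}. ennreal \<bar>m' t x - m' \<theta> x\<bar>) else \<top>)"

definition tau_bar ::
  "(nat \<Rightarrow> 'w measure) \<Rightarrow> (nat \<Rightarrow> nat \<Rightarrow> 'w \<Rightarrow> 'x) \<Rightarrow> real set \<Rightarrow> (nat \<Rightarrow> nat \<Rightarrow> real \<Rightarrow> 'x \<Rightarrow> real) \<Rightarrow> real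
    \<Rightarrow> nat \<Rightarrow> real \<Rightarrow> ennreal"
  where "tau_bar P X \<Theta> M' \<theta> n \<delta> =
    (\<Sum>i=1..n. \<integral>\<^sup>+\<omega>. tau \<Theta> (M' n i) \<theta> \<delta> (X n i \<omega>) \<partial>P n) / ennreal \<bar>J_sum P X M' \<theta> n\<bar>"

text \<open>
  Convergence in probability; the \<open>ennreal\<close> version is needed because \<open>tau_bar\<close> may be infinite.
  Both modes of convergence include that the variables are measurable, because
  \<open>measure\<close> and \<open>distr\<close> are meaningless for non-measurable sets and functions.
\<close>

definition conv_in_prob_0 :: "(nat \<Rightarrow> 'w measure) \<Rightarrow> (nat \<Rightarrow> 'w \<Rightarrow> ennreal) \<Rightarrow> bool"
  where "conv_in_prob_0 P Y \<longleftrightarrow>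
    (\<forall>n. Y n \<in> borel_measurable (P n)) \<and>
    (\<forall>\<epsilon>>0. (\<lambda>n. measure (P n) {\<omega> \<in> space (P n). ennreal \<epsilon> < Y n \<omega>}) \<longlonglongrightarrow> 0)"

definition conv_in_prob :: "(nat \<Rightarrow> 'w measure) \<Rightarrow> (nat \<Rightarrow> 'w \<Rightarrow> real) \<Rightarrow> real \<Rightarrow> bool"
  where "conv_in_prob P Y c \<longleftrightarrow>
    (\<forall>n. Y n \<in> borel_measurable (P n)) \<and>
    (\<forall>\<epsilon>>0. (\<lambda>n. measure (P n) {\<omega> \<in> space (P n). \<epsilon> < \<bar>Y n \<omega> - c\<bar>}) \<longlonglongrightarrow> 0)"

definition conv_in_dist :: "(nat \<Rightarrow> 'w measure) \<Rightarrow> (nat \<Rightarrow> 'w \<Rightarrow> real) \<Rightarrow> real measure \<Rightarrow> bool"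
  where "conv_in_dist P Y \<mu> \<longleftrightarrow>
    (\<forall>n. Y n \<in> borel_measurable (P n)) \<and> weak_conv_m (\<lambda>n. distr (P n) borel (Y n)) \<mu>"

definition defined_wpt1 :: "(nat \<Rightarrow> 'w measure) \<Rightarrow> (nat \<Rightarrow> 'w \<Rightarrow> bool) \<Rightarrow> bool"
  where "defined_wpt1 P D \<longleftrightarrow> (\<lambda>n. measure (P n) {\<omega> \<in> space (P n). D n \<omega>}) \<longlonglongrightarrow> 1"

definition sample :: "(nat \<Rightarrow> nat \<Rightarrow> 'w \<Rightarrow> 'x) \<Rightarrow> nat \<Rightarrow> 'w \<Rightarrow> nat \<Rightarrow> 'x"
  where "sample X n \<omega> = (\<lambda>i\<in>{1..n}. X n i \<omega>)"

text \<open>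
  Statistics are functions of the sample \<open>x\<close>.  Where a quantity in their definition is undefined
  they get the value \<open>0\<close>; this has no influence on limits in distribution once
  the statistic is defined with probability tending to 1.
\<close>

definition one_step_defined ::
  "real set \<Rightarrow> (nat \<Rightarrow> (nat \<Rightarrow> 'x) \<Rightarrow> real) \<Rightarrow> (nat \<Rightarrow> (nat \<Rightarrow> 'x) \<Rightarrow> real) \<Rightarrow> nat \<Rightarrow> (nat \<Rightarrow> 'x) \<Rightarrow> bool"
  where "one_step_defined \<Theta> T Js n x \<longleftrightarrow> T n x \<in> \<Theta> \<and> Js n x \<noteq> 0"

definition one_step ::
  "real set \<Rightarrow> (nat \<Rightarrow> nat \<Rightarrow> real \<Rightarrow> 'x \<Rightarrow> real) \<Rightarrow> (nat \<Rightarrow> (nat \<Rightarrow> 'x) \<Rightarrow> real) \<Rightarrow> (nat \<Rightarrow> (nat \<Rightarrow> 'x) \<Rightarrow> real)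
    \<Rightarrow> nat \<Rightarrow> (nat \<Rightarrow> 'x) \<Rightarrow> real"
  where "one_step \<Theta> M T Js n x =
    (if one_step_defined \<Theta> T Js n x
     then T n x - (\<Sum>i=1..n. M n i (T n x) (x i)) / Js n x
     else 0)"

definition d_stat_defined ::
  "real set \<Rightarrow> (nat \<Rightarrow> nat \<Rightarrow> real \<Rightarrow> 'x \<Rightarrow> real) \<Rightarrow> (nat \<Rightarrow> (nat \<Rightarrow> 'x) \<Rightarrow> real) \<Rightarrow> (nat \<Rightarrow> (nat \<Rightarrow> 'x) \<Rightarrow> real)
    \<Rightarrow> nat \<Rightarrow> (nat \<Rightarrow> 'x) \<Rightarrow> bool"
  where "d_stat_defined \<Theta> M T Js n x \<longleftrightarrow>
    one_step_defined \<Theta> T Js n x \<and> one_step \<Theta> M T Js n x \<in> \<Theta> \<and>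
    (\<Sum>i=1..n. (M n i (one_step \<Theta> M T Js n x) (x i))\<^sup>2) \<noteq> 0"

definition d_stat ::
  "real set \<Rightarrow> (nat \<Rightarrow> nat \<Rightarrow> real \<Rightarrow> 'x \<Rightarrow> real) \<Rightarrow> (nat \<Rightarrow> (nat \<Rightarrow> 'x) \<Rightarrow> real) \<Rightarrow> (nat \<Rightarrow> (nat \<Rightarrow> 'x) \<Rightarrow> real)
    \<Rightarrow> nat \<Rightarrow> (nat \<Rightarrow> 'x) \<Rightarrow> real"
  where "d_stat \<Theta> M T Js n x =
    (if d_stat_defined \<Theta> M T Js n x
     then Js n x / sqrt (\<Sum>i=1..n. (M n i (one_step \<Theta> M T Js n x) (x i))\<^sup>2)
     else 0)"

end

theory Submission
  imports Defs
begin

text \<open>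
  Put \<open>R\<^sub>n = \<bar>J\<^sub>n\<bar> / \<surd>I\<^sub>n\<close> and \<open>D = \<theta>\<^sup>* - \<theta>\<close>.  Expanding \<open>\<Sum> M\<^sub>i(\<theta>\<^sup>*)\<close> at \<open>\<theta>\<close> with a remainder bounded by
  \<open>\<bar>D\<bar> \<Sum> \<tau>\<^sub>i(\<bar>D\<bar>)\<close>, the normalised error of the one-step estimator is \<open>J\<^sub>n / J\<^sub>n\<^sup>*\<close> times the negated
  normalised score, up to a term controlled by (e) and a term of size \<open>R\<^sub>n \<bar>D\<bar> \<Sum> \<tau>\<^sub>i(\<bar>D\<bar>) / \<bar>J\<^sub>n\<bar>\<close>.
  Assumption (d) only controls the mean of that last expression at deterministic arguments, but it is
  nondecreasing in \<open>\<bar>D\<bar>\<close>: on the (deterministic) interval of arguments where its mean is small, its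
  supremum has small mean by monotone convergence, so Markov's inequality applies to the random argument.
  For the studentized version the same device with (c), and Minkowski's inequality in \<open>\<ell>\<^sup>2{1..n}\<close>, give
  \<open>\<Sum> M\<^sub>i(\<theta>\<^sup>*\<^sup>*)\<^sup>2 / I\<^sub>n \<rightarrow> 1\<close> in probability.
\<close>

section \<open>Events with probability tending to one\<close>

text \<open>
  The properties of \<open>(n, \<omega>)\<close> that hold with probability tending to one form a filter, and
  convergence in probability is ordinary convergence along it, so the limit calculus of the library
  applies.
\<close>

definition prob_filter :: "(nat \<Rightarrow> 'w measure) \<Rightarrow> (nat \<times> 'w) filter"
  where "prob_filter Q = Abs_filter (\<lambda>D. \<forall>\<eta>>0. \<forall>\<^sub>F n in sequentially.
    \<exists>A\<in>sets (Q n). measure (Q n) A < \<eta> \<and> (\<forall>\<omega>\<in>space (Q n) - A. D (n, \<omega>)))"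

text \<open>An event is controlled through a measurable exceptional set \<open>A\<close>, so that
  non-measurable events are covered as well. Closure under conjunction holds because two exceptional
  sets of measure below \<open>\<eta> / 2\<close> have a union of measure below
  \<open>\<eta>\<close>.\<close>

lemma eventually_prob_filter:
  "eventually D (prob_filter Q) \<longleftrightarrow> (\<forall>\<eta>>0. \<forall>\<^sub>F n in sequentially.
    \<exists>A\<in>sets (Q n). measure (Q n) A < \<eta> \<and> (\<forall>\<omega>\<in>space (Q n) - A. D (n, \<omega>)))"
  unfolding prob_filter_def
proof (rule eventually_Abs_filter, unfold_locales, goal_cases)
  case 1
  then show ?case by (auto intro!: always_eventually bexI[of _ "{}"])
next
  case (2 P R)
  show ?case
  proof (intro allI impI)
    fix \<eta> :: real assume "\<eta> > 0"
    then have "\<eta> / 2 > 0" by simp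
    with 2 have "\<forall>\<^sub>F n in sequentially.
        \<exists>A\<in>sets (Q n). measure (Q n) A < \<eta> / 2 \<and> (\<forall>\<omega>\<in>space (Q n) - A. P (n, \<omega>))"
      and "\<forall>\<^sub>F n in sequentially.
        \<exists>A\<in>sets (Q n). measure (Q n) A < \<eta> / 2 \<and> (\<forall>\<omega>\<in>space (Q n) - A. R (n, \<omega>))"
      by blast+
    then show "\<forall>\<^sub>F n in sequentially.
        \<exists>A\<in>sets (Q n). measure (Q n) A < \<eta> \<and> (\<forall>\<omega>\<in>space (Q n) - A. P (n, \<omega>) \<and> R (n, \<omega>))"
    proof eventually_elim
      case (elim n)
      then obtain A B where AB: "A \<in> sets (Q n)" "measure (Q n) A < \<eta> / 2" "\<forall>\<omega>\<in>space (Q n) - A. P (n, \<omega>)"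
        "B \<in> sets (Q n)" "measure (Q n) B < \<eta> / 2" "\<forall>\<omega>\<in>space (Q n) - B. R (n, \<omega>)"
        by blast
      then have "measure (Q n) (A \<union> B) < \<eta>"
        using measure_Un_le[of A "Q n" B] by simp
      with AB show ?case by (intro bexI[of _ "A \<union> B"]) auto
    qed
  qed
next
  case (3 P R)
  show ?case
  proof (intro allI impI)
    fix \<eta> :: real assume "\<eta> > 0"
    with 3 have "\<forall>\<^sub>F n in sequentially.
        \<exists>A\<in>sets (Q n). measure (Q n) A < \<eta> \<and> (\<forall>\<omega>\<in>space (Q n) - A. P (n, \<omega>))"
      by blast
    then show "\<forall>\<^sub>F n in sequentially.
        \<exists>A\<in>sets (Q n). measure (Q n) A < \<eta> \<and> (\<forall>\<omega>\<in>space (Q n) - A. R (n, \<omega>))"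
      by eventually_elim (use 3(1) in blast)
  qed
qed

lemma eventually_prob_filterI_fst:
  assumes "\<forall>\<^sub>F n in sequentially. D n"
  shows "\<forall>\<^sub>F z in prob_filter Q. D (fst z)"
  unfolding eventually_prob_filter
proof (intro allI impI)
  fix \<eta> :: real assume "\<eta> > 0"
  from assms show "\<forall>\<^sub>F n in sequentially.
      \<exists>A\<in>sets (Q n). measure (Q n) A < \<eta> \<and> (\<forall>\<omega>\<in>space (Q n) - A. D (fst (n, \<omega>)))"
    by eventually_elim (use \<open>\<eta> > 0\<close> in \<open>auto intro!: bexI[of _ "{}"]\<close>)
qed

text \<open>Deterministic limits in \<open>n\<close>, such as the rate in (b), carry over to the
  filter by composition.\<close>

lemma filterlim_fst_prob_filter: "filterlim fst sequentially (prob_filter Q)"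
  unfolding filterlim_iff using eventually_prob_filterI_fst by blast

lemma eventually_prob_filterI_AE:
  assumes "\<And>n. AE \<omega> in Q n. D (n, \<omega>)"
  shows "eventually D (prob_filter Q)"
  unfolding eventually_prob_filter
proof (intro allI impI always_eventually)
  fix \<eta> :: real and n assume "\<eta> > 0"
  obtain N where N: "\<And>\<omega>. \<omega> \<in> space (Q n) - N \<Longrightarrow> D (n, \<omega>)" "N \<in> null_sets (Q n)"
    by (rule AE_E3[OF assms[of n]]) (rule that)
  then have "measure (Q n) N = 0" by (simp add: measure_eq_0_null_sets)
  with N \<open>\<eta> > 0\<close> show "\<exists>A\<in>sets (Q n). measure (Q n) A < \<eta> \<and> (\<forall>\<omega>\<in>space (Q n) - A. D (n, \<omega>))"
    by (intro bexI[of _ N] conjI ballI) (simp_all add: null_setsD2)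
qed

lemma eventually_prob_filterI_measure:
  assumes "\<And>n. {\<omega> \<in> space (Q n). \<not> D (n, \<omega>)} \<in> sets (Q n)"
    and "(\<lambda>n. measure (Q n) {\<omega> \<in> space (Q n). \<not> D (n, \<omega>)}) \<longlonglongrightarrow> 0"
  shows "eventually D (prob_filter Q)"
  unfolding eventually_prob_filter
proof (intro allI impI)
  fix \<eta> :: real assume "\<eta> > 0"
  from order_tendstoD(2)[OF assms(2) this] show "\<forall>\<^sub>F n in sequentially.
      \<exists>A\<in>sets (Q n). measure (Q n) A < \<eta> \<and> (\<forall>\<omega>\<in>space (Q n) - A. D (n, \<omega>))"
    by eventually_elim (rule bexI[of _ "{\<omega> \<in> space (Q _). \<not> D (_, \<omega>)}"], use assms(1) in auto)
qed

text \<open>The event of failure lies inside the measurable exceptional set \<open>A\<close>, and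
  monotonicity of the measure does the rest. This is the way back from the filter to the measures of
  events.\<close>

lemma measure_tendsto_0_of_eventually_prob_filter:
  assumes "\<And>n. finite_measure (Q n)" and "eventually D (prob_filter Q)"
  shows "(\<lambda>n. measure (Q n) {\<omega> \<in> space (Q n). \<not> D (n, \<omega>)}) \<longlonglongrightarrow> 0"
proof (rule order_tendstoI)
  fix \<eta> :: real assume "\<eta> > 0"
  with assms(2) have "\<forall>\<^sub>F n in sequentially.
      \<exists>A\<in>sets (Q n). measure (Q n) A < \<eta> \<and> (\<forall>\<omega>\<in>space (Q n) - A. D (n, \<omega>))"
    unfolding eventually_prob_filter by blast
  then show "\<forall>\<^sub>F n in sequentially. measure (Q n) {\<omega> \<in> space (Q n). \<not> D (n, \<omega>)} < \<eta>"
  proof eventually_elim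
    case (elim n)
    then obtain A where A: "A \<in> sets (Q n)" "measure (Q n) A < \<eta>" "\<forall>\<omega>\<in>space (Q n) - A. D (n, \<omega>)"
      by blast
    then have "measure (Q n) {\<omega> \<in> space (Q n). \<not> D (n, \<omega>)} \<le> measure (Q n) A"
      by (intro finite_measure.finite_measure_mono[OF assms(1)]) auto
    with A show ?case by simp
  qed
qed (auto intro!: always_eventually intro: less_le_trans[OF _ measure_nonneg])

lemma defined_wpt1I:
  assumes "\<And>n. prob_space (Q n)" and "\<And>n. {\<omega> \<in> space (Q n). D n \<omega>} \<in> sets (Q n)"
    and "\<forall>\<^sub>F z in prob_filter Q. D (fst z) (snd z)"
  shows "defined_wpt1 Q D"
proof -
  have "(\<lambda>n. measure (Q n) {\<omega> \<in> space (Q n). \<not> D n \<omega>}) \<longlonglongrightarrow> 0"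
    using measure_tendsto_0_of_eventually_prob_filter[OF _ assms(3)] assms(1)
    by (simp add: prob_space.finite_measure)
  then have "(\<lambda>n. 1 - measure (Q n) {\<omega> \<in> space (Q n). \<not> D n \<omega>}) \<longlonglongrightarrow> 1 - 0"
    by (intro tendsto_intros)
  moreover have "1 - measure (Q n) {\<omega> \<in> space (Q n). \<not> D n \<omega>} = measure (Q n) {\<omega> \<in> space (Q n). D n \<omega>}" for n
    using prob_space.prob_neg[OF assms(1), of n "D n"] assms(2)[of n] by simp
  ultimately show ?thesis unfolding defined_wpt1_def by simp
qed

lemma conv_in_prob_imp_tendsto:
  assumes "conv_in_prob Q Y c"
  shows "((\<lambda>z. Y (fst z) (snd z)) \<longlongrightarrow> c) (prob_filter Q)"
proof (rule tendstoI)
  fix \<epsilon> :: real assume "\<epsilon> > 0"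
  have [measurable]: "Y n \<in> borel_measurable (Q n)" for n
    using assms by (simp add: conv_in_prob_def)
  \<comment> \<open>Half of \<open>\<epsilon>\<close>, because negating a strict inequality only
    gives \<open>\<le>\<close>, while \<open>dist\<close> must be strictly smaller.\<close>
  have "(\<lambda>n. measure (Q n) {\<omega> \<in> space (Q n). \<epsilon> / 2 < \<bar>Y n \<omega> - c\<bar>}) \<longlonglongrightarrow> 0"
    using assms \<open>\<epsilon> > 0\<close> unfolding conv_in_prob_def using half_gt_zero by blast
  then have "\<forall>\<^sub>F z in prob_filter Q. \<not> \<epsilon> / 2 < \<bar>Y (fst z) (snd z) - c\<bar>"
    by (intro eventually_prob_filterI_measure) (simp_all, measurable)
  then show "\<forall>\<^sub>F z in prob_filter Q. dist (Y (fst z) (snd z)) c < \<epsilon>"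
    by eventually_elim (use \<open>\<epsilon> > 0\<close> in \<open>auto simp: dist_real_def\<close>)
qed

lemma conv_in_prob_0_imp_tendsto:
  assumes "conv_in_prob_0 Q Y"
  shows "((\<lambda>z. Y (fst z) (snd z)) \<longlongrightarrow> 0) (prob_filter Q)"
proof (rule order_tendstoI)
  fix a :: ennreal assume "a > 0"
  \<comment> \<open>A value strictly between \<open>0\<close> and \<open>a\<close> is finite even
    when \<open>a\<close> is \<open>\<top>\<close>, hence comes from a real
    \<open>\<epsilon>\<close>.\<close>
  then obtain b where b: "0 < b" "b < a" using dense by blast
  then obtain \<epsilon> :: real where \<epsilon>: "b = ennreal \<epsilon>" "\<epsilon> > 0"
    by (cases b) auto
  have [measurable]: "Y n \<in> borel_measurable (Q n)" for n
    using assms by (simp add: conv_in_prob_0_def)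
  have "(\<lambda>n. measure (Q n) {\<omega> \<in> space (Q n). ennreal \<epsilon> < Y n \<omega>}) \<longlonglongrightarrow> 0"
    using assms \<epsilon>(2) by (simp add: conv_in_prob_0_def)
  then have "\<forall>\<^sub>F z in prob_filter Q. \<not> ennreal \<epsilon> < Y (fst z) (snd z)"
    by (intro eventually_prob_filterI_measure) (simp_all, measurable)
  then show "\<forall>\<^sub>F z in prob_filter Q. Y (fst z) (snd z) < a"
    by eventually_elim (use b \<epsilon> in auto)
qed simp

text \<open>Tightness of the laws of \<open>Y n\<close> for large \<open>n\<close>, phrased with
  exceptional sets so that it combines directly with \<open>prob_filter\<close>.\<close>

definition bounded_in_prob :: "(nat \<Rightarrow> 'w measure) \<Rightarrow> (nat \<Rightarrow> 'w \<Rightarrow> real) \<Rightarrow> bool"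
  where "bounded_in_prob Q Y \<longleftrightarrow> (\<forall>\<eta>>0. \<exists>K. \<forall>\<^sub>F n in sequentially.
    \<exists>A\<in>sets (Q n). measure (Q n) A < \<eta> \<and> (\<forall>\<omega>\<in>space (Q n) - A. \<bar>Y n \<omega>\<bar> \<le> K))"

text \<open>Off two exceptional sets one factor is at most \<open>K\<close> and the other below
  \<open>\<epsilon> / K\<close>: a quantity tending to 0 in probability stays so after
  multiplication by a tight one.\<close>

lemma tendsto_0_mult_bounded_in_prob:
  assumes "bounded_in_prob Q Y" and "(Z \<longlongrightarrow> 0) (prob_filter Q)"
  shows "((\<lambda>z. Z z * Y (fst z) (snd z)) \<longlongrightarrow> (0::real)) (prob_filter Q)"
proof (rule tendstoI, unfold eventually_prob_filter, intro allI impI)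
  fix \<epsilon> \<eta> :: real assume "\<epsilon> > 0" "\<eta> > 0"
  then have "\<eta> / 2 > 0" by simp
  then obtain K0 where K0: "\<forall>\<^sub>F n in sequentially.
    \<exists>A\<in>sets (Q n). measure (Q n) A < \<eta> / 2 \<and> (\<forall>\<omega>\<in>space (Q n) - A. \<bar>Y n \<omega>\<bar> \<le> K0)"
    using assms(1) unfolding bounded_in_prob_def by blast
  \<comment> \<open>The maximum with 1 makes the bound positive, so that dividing by
    \<open>K\<close> is legitimate.\<close>
  define K where "K = max K0 1"
  have "\<epsilon> / K > 0" using \<open>\<epsilon> > 0\<close> by (simp add: K_def)
  from tendstoD[OF assms(2) this] have "\<forall>\<^sub>F n in sequentially.
    \<exists>A\<in>sets (Q n). measure (Q n) A < \<eta> / 2 \<and> (\<forall>\<omega>\<in>space (Q n) - A. dist (Z (n, \<omega>)) 0 < \<epsilon> / K)"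
    using \<open>\<eta> / 2 > 0\<close> unfolding eventually_prob_filter by blast
  with K0 show "\<forall>\<^sub>F n in sequentially. \<exists>A\<in>sets (Q n). measure (Q n) A < \<eta> \<and>
      (\<forall>\<omega>\<in>space (Q n) - A. dist (Z (n, \<omega>) * Y (fst (n, \<omega>)) (snd (n, \<omega>))) 0 < \<epsilon>)"
  proof eventually_elim
    case (elim n)
    then obtain A B where AB: "A \<in> sets (Q n)" "measure (Q n) A < \<eta> / 2" "\<forall>\<omega>\<in>space (Q n) - A. \<bar>Y n \<omega>\<bar> \<le> K0"
      "B \<in> sets (Q n)" "measure (Q n) B < \<eta> / 2" "\<forall>\<omega>\<in>space (Q n) - B. dist (Z (n, \<omega>)) 0 < \<epsilon> / K"
      by blast
    have "measure (Q n) (A \<union> B) < \<eta>"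
      using AB measure_Un_le[of A "Q n" B] by simp
    moreover have "\<bar>Z (n, \<omega>) * Y n \<omega>\<bar> < \<epsilon>" if "\<omega> \<in> space (Q n) - (A \<union> B)" for \<omega>
    proof -
      have "\<bar>Y n \<omega>\<bar> \<le> K" "\<bar>Z (n, \<omega>)\<bar> < \<epsilon> / K" using AB that by (force simp: K_def)+
      then have "\<bar>Z (n, \<omega>)\<bar> * \<bar>Y n \<omega>\<bar> \<le> \<bar>Z (n, \<omega>)\<bar> * K" "\<bar>Z (n, \<omega>)\<bar> * K < \<epsilon>"
        by (auto intro: mult_left_mono simp: pos_less_divide_eq K_def)
      then show ?thesis by (simp add: abs_mult)
    qed
    ultimately show ?case using AB by (intro bexI[of _ "A \<union> B"]) auto
  qed
qed

lemma bounded_in_prob_abs: "bounded_in_prob Q Y \<Longrightarrow> bounded_in_prob Q (\<lambda>n \<omega>. \<bar>Y n \<omega>\<bar>)"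
  by (simp add: bounded_in_prob_def)

text \<open>Both tails of \<open>\<mu>\<close> beyond a suitable \<open>K\<close> have small mass,
  and convergence of the distribution functions at \<open>K\<close> and \<open>- K\<close> passes
  this on to \<open>Y n\<close>.\<close>

lemma conv_in_dist_imp_bounded_in_prob:
  assumes prob: "\<And>n. prob_space (Q n)" and "real_distribution \<mu>" and conv: "conv_in_dist Q Y \<mu>"
  shows "bounded_in_prob Q Y"
  unfolding bounded_in_prob_def
proof (intro allI impI)
  fix \<eta> :: real assume "\<eta> > 0"
  interpret \<mu>: real_distribution \<mu> by fact
  have [measurable]: "Y n \<in> borel_measurable (Q n)" for n
    using conv by (simp add: conv_in_dist_def)
  have "\<forall>\<^sub>F K in at_top. cdf \<mu> K > 1 - \<eta> / 2"
    using order_tendstoD(1)[OF \<mu>.cdf_lim_at_top_prob] \<open>\<eta> > 0\<close> by simp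
  moreover have "((\<lambda>K. cdf \<mu> (- K)) \<longlongrightarrow> 0) at_top"
    using filterlim_compose[OF \<mu>.cdf_lim_at_bot filterlim_uminus_at_bot_at_top] .
  then have "\<forall>\<^sub>F K in at_top. cdf \<mu> (- K) < \<eta> / 2"
    using order_tendstoD(2) \<open>\<eta> > 0\<close> half_gt_zero by blast
  ultimately have "\<forall>\<^sub>F K in at_top. cdf \<mu> K > 1 - \<eta> / 2 \<and> cdf \<mu> (- K) < \<eta> / 2"
    by eventually_elim simp
  then obtain K0 where K0: "\<And>K. K \<ge> K0 \<Longrightarrow> cdf \<mu> K > 1 - \<eta> / 2 \<and> cdf \<mu> (- K) < \<eta> / 2"
    by (auto simp: eventually_at_top_linorder)
  \<comment> \<open>The atoms of \<open>\<mu>\<close>, where \<open>cdf \<mu>\<close> jumps. There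
    are only countably many, so some \<open>K\<close> just above \<open>K0\<close> makes both
    \<open>K\<close> and \<open>- K\<close> continuity points.\<close>
  let ?C = "{x. measure \<mu> {x} > 0}"
  have "countable (?C \<union> uminus ` ?C)"
    using \<mu>.countable_support by (simp add: zero_less_measure_iff)
  then obtain K where K: "K \<in> {K0<..<K0 + 1}" "K \<notin> ?C \<union> uminus ` ?C"
    using real_interval_avoid_countable_set[of K0 "K0 + 1" "?C \<union> uminus ` ?C"] by (meson less_add_one)
  then have "K \<notin> ?C" by blast
  moreover have "- K \<notin> ?C"
  proof
    assume "- K \<in> ?C"
    then have "- (- K) \<in> uminus ` ?C" by (rule imageI)
    with K(2) show False by simp
  qed
  ultimately have "isCont (cdf \<mu>) K" "isCont (cdf \<mu>) (- K)"
    by (auto simp: \<mu>.isCont_cdf less_le)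
  then have "(\<lambda>n. cdf (distr (Q n) borel (Y n)) K) \<longlonglongrightarrow> cdf \<mu> K"
    "(\<lambda>n. cdf (distr (Q n) borel (Y n)) (- K)) \<longlonglongrightarrow> cdf \<mu> (- K)"
    using conv by (auto simp: conv_in_dist_def weak_conv_m_def weak_conv_def)
  then have "\<forall>\<^sub>F n in sequentially. cdf (distr (Q n) borel (Y n)) K > 1 - \<eta> / 2"
    "\<forall>\<^sub>F n in sequentially. cdf (distr (Q n) borel (Y n)) (- K) < \<eta> / 2"
    using K0[of K] K(1) by (intro order_tendstoD; simp)+
  then show "\<exists>K. \<forall>\<^sub>F n in sequentially.
      \<exists>A\<in>sets (Q n). measure (Q n) A < \<eta> \<and> (\<forall>\<omega>\<in>space (Q n) - A. \<bar>Y n \<omega>\<bar> \<le> K)"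
  proof (intro exI[of _ K], eventually_elim)
    case (elim n)
    interpret Qn: prob_space "Q n" by (rule prob)
    let ?A = "{\<omega>\<in>space (Q n). \<not> Y n \<omega> \<le> K}" and ?B = "{\<omega>\<in>space (Q n). Y n \<omega> \<le> - K}"
    have cdf_eq: "cdf (distr (Q n) borel (Y n)) x = measure (Q n) {\<omega>\<in>space (Q n). Y n \<omega> \<le> x}" for x
      by (auto simp: cdf_def measure_distr intro: arg_cong[where f = "measure _"])
    have "measure (Q n) (?A \<union> ?B) \<le> measure (Q n) ?A + measure (Q n) ?B"
      by (intro measure_Un_le) measurable
    also have "measure (Q n) ?A = 1 - measure (Q n) {\<omega>\<in>space (Q n). Y n \<omega> \<le> K}"
      by (rule Qn.prob_neg) measurable
    finally have "measure (Q n) (?A \<union> ?B) < \<eta>" using elim by (simp add: cdf_eq)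
    then show ?case by (intro bexI[of _ "?A \<union> ?B"]) auto
  qed
qed

section \<open>Slutsky's theorem\<close>

text \<open>Proved with characteristic functions: the map from \<open>x\<close> to
  \<open>iexp (t * x)\<close> is Lipschitz with constant \<open>\<bar>t\<bar>\<close> and has
  modulus 1, so the transforms of \<open>Y'\<close> and \<open>Y\<close> differ by at most
  \<open>\<bar>t\<bar> * \<delta>\<close> plus twice the probability that \<open>Y'\<close> and
  \<open>Y\<close> are at least \<open>\<delta>\<close> apart. Levy's continuity theorem is used in
  both directions.\<close>

lemma conv_in_dist_converging_together:
  assumes prob: "\<And>n. prob_space (Q n)" and \<mu>: "real_distribution \<mu>" and conv: "conv_in_dist Q Y \<mu>"
    and Y'[measurable]: "\<And>n. Y' n \<in> borel_measurable (Q n)"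
    and diff: "((\<lambda>z. Y' (fst z) (snd z) - Y (fst z) (snd z)) \<longlongrightarrow> 0) (prob_filter Q)"
  shows "conv_in_dist Q Y' \<mu>"
proof -
  have Y[measurable]: "Y n \<in> borel_measurable (Q n)" for n
    using conv by (simp add: conv_in_dist_def)
  have distr: "real_distribution (distr (Q n) borel Z)" if "Z \<in> borel_measurable (Q n)" for n Z
    using that prob_space.real_distribution_distr[OF prob] by blast
  have "(\<lambda>n. char (distr (Q n) borel (Y' n)) t - char (distr (Q n) borel (Y n)) t) \<longlonglongrightarrow> 0" for t
  proof (rule tendstoI)
    fix \<epsilon> :: real assume "\<epsilon> > 0"
    \<comment> \<open>The summand 1 covers \<open>t = 0\<close>. The Lipschitz term stays below
      \<open>\<epsilon> / 2\<close>, and the bad event, which counts twice, is allowed probability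
      \<open>\<epsilon> / 4\<close>.\<close>
    define \<delta> where "\<delta> = \<epsilon> / (2 * (\<bar>t\<bar> + 1))"
    have "\<delta> > 0" using \<open>\<epsilon> > 0\<close> by (simp add: \<delta>_def)
    have t\<delta>: "\<bar>t\<bar> * \<delta> < \<epsilon> / 2" using \<open>\<epsilon> > 0\<close> by (simp add: \<delta>_def field_simps)
    have "(\<lambda>n. measure (Q n) {\<omega>\<in>space (Q n). \<not> \<bar>Y' n \<omega> - Y n \<omega>\<bar> < \<delta>}) \<longlonglongrightarrow> 0"
      using measure_tendsto_0_of_eventually_prob_filter[OF _ tendstoD[OF diff \<open>\<delta> > 0\<close>]] prob
      by (simp add: prob_space.finite_measure dist_real_def)
    moreover have "\<epsilon> / 4 > 0" using \<open>\<epsilon> > 0\<close> by simp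
    ultimately have "\<forall>\<^sub>F n in sequentially. measure (Q n) {\<omega>\<in>space (Q n). \<not> \<bar>Y' n \<omega> - Y n \<omega>\<bar> < \<delta>} < \<epsilon> / 4"
      by (rule order_tendstoD)
    then show "\<forall>\<^sub>F n in sequentially.
        dist (char (distr (Q n) borel (Y' n)) t - char (distr (Q n) borel (Y n)) t) 0 < \<epsilon>"
    proof eventually_elim
      case (elim n)
      interpret Qn: prob_space "Q n" by (rule prob)
      let ?B = "{\<omega>\<in>space (Q n). \<not> \<bar>Y' n \<omega> - Y n \<omega>\<bar> < \<delta>}"
      have [measurable]: "?B \<in> sets (Q n)" by measurable
      have int: "integrable (Q n) (\<lambda>\<omega>. iexp (t * Z \<omega>))" if [measurable]: "Z \<in> borel_measurable (Q n)" for Z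
        by (intro Qn.integrable_const_bound[of _ 1]) auto
      have bound: "cmod (iexp (t * Y' n \<omega>) - iexp (t * Y n \<omega>)) \<le> \<bar>t\<bar> * \<delta> + 2 * indicator ?B \<omega>"
        if "\<omega> \<in> space (Q n)" for \<omega>
      proof (cases "\<omega> \<in> ?B")
        case True
        then show ?thesis using norm_triangle_ineq4[of "iexp (t * Y' n \<omega>)" "iexp (t * Y n \<omega>)"] \<open>\<delta> > 0\<close>
          by (simp del: of_real_mult add: add_increasing)
      next
        case False
        have "iexp (t * Y' n \<omega>) - iexp (t * Y n \<omega>) = iexp (t * Y n \<omega>) * (iexp (t * (Y' n \<omega> - Y n \<omega>)) - 1)"
          by (simp add: algebra_simps flip: exp_add)
        then have "cmod (iexp (t * Y' n \<omega>) - iexp (t * Y n \<omega>)) = cmod (iexp (t * (Y' n \<omega> - Y n \<omega>)) - 1)"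
          by (simp add: norm_mult del: of_real_mult of_real_diff)
        also have "\<dots> \<le> \<bar>t * (Y' n \<omega> - Y n \<omega>)\<bar>"
          using iexp_approx1[of "t * (Y' n \<omega> - Y n \<omega>)" 0] by simp
        also have "\<dots> \<le> \<bar>t\<bar> * \<delta>" using False that by (auto simp: abs_mult intro!: mult_left_mono)
        finally show ?thesis using False by simp
      qed
      have "char (distr (Q n) borel (Y' n)) t - char (distr (Q n) borel (Y n)) t =
          (CLINT \<omega>|Q n. iexp (t * Y' n \<omega>) - iexp (t * Y n \<omega>))"
        using int[of "Y' n"] int[of "Y n"] by (simp add: char_def integral_distr)
      also have "cmod \<dots> \<le> (LINT \<omega>|Q n. cmod (iexp (t * Y' n \<omega>) - iexp (t * Y n \<omega>)))"
        by (rule integral_norm_bound)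
      also have "\<dots> \<le> (LINT \<omega>|Q n. \<bar>t\<bar> * \<delta> + 2 * indicator ?B \<omega>)"
        using int[of "Y' n"] int[of "Y n"] bound
        by (intro integral_mono Bochner_Integration.integrable_add integrable_mult_right integrable_norm
            Bochner_Integration.integrable_diff Qn.integrable_const integrable_real_indicator)
          (auto simp: Qn.emeasure_finite less_top[symmetric])
      also have "\<dots> = \<bar>t\<bar> * \<delta> + 2 * measure (Q n) ?B"
        by (subst Bochner_Integration.integral_add)
          (auto simp: Qn.prob_space Qn.emeasure_finite less_top[symmetric])
      also have "\<dots> < \<epsilon>" using elim t\<delta> by simp
      finally show ?case by simp
    qed
  qed
  moreover have "(\<lambda>n. char (distr (Q n) borel (Y n)) t) \<longlonglongrightarrow> char \<mu> t" for t
    using conv distr[OF Y] \<mu> by (intro levy_continuity1) (auto simp: conv_in_dist_def)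
  ultimately have "(\<lambda>n. char (distr (Q n) borel (Y' n)) t) \<longlonglongrightarrow> char \<mu> t" for t
    using tendsto_add[of "\<lambda>n. char (distr (Q n) borel (Y' n)) t - char (distr (Q n) borel (Y n)) t" 0 sequentially
      "\<lambda>n. char (distr (Q n) borel (Y n)) t" "char \<mu> t"] by simp
  then show ?thesis unfolding conv_in_dist_def
    using distr[OF Y'] \<mu> by (auto intro: levy_continuity)
qed

text \<open>The normal characteristic function is even. The sign change is needed because the
  expansion of the estimator produces the negated score.\<close>

lemma conv_in_dist_uminus_std_normal:
  assumes prob: "\<And>n. prob_space (Q n)" and conv: "conv_in_dist Q Y std_normal_distribution"
  shows "conv_in_dist Q (\<lambda>n \<omega>. - Y n \<omega>) std_normal_distribution"
proof -
  have Y[measurable]: "Y n \<in> borel_measurable (Q n)" for n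
    using conv by (simp add: conv_in_dist_def)
  have distr: "real_distribution (distr (Q n) borel Z)" if "Z \<in> borel_measurable (Q n)" for n Z
    using that prob_space.real_distribution_distr[OF prob] by blast
  have "(\<lambda>n. char (distr (Q n) borel (Y n)) (- t)) \<longlonglongrightarrow> char std_normal_distribution t" for t
  proof -
    have "char std_normal_distribution (- t) = char std_normal_distribution t"
      by (simp add: char_std_normal_distribution)
    moreover have "(\<lambda>n. char (distr (Q n) borel (Y n)) (- t)) \<longlonglongrightarrow> char std_normal_distribution (- t)"
    using conv distr[OF Y] real_dist_normal_dist by (intro levy_continuity1) (auto simp: conv_in_dist_def)
    ultimately show ?thesis by simp
  qed
  then have "(\<lambda>n. char (distr (Q n) borel (\<lambda>\<omega>. - Y n \<omega>)) t) \<longlonglongrightarrow> char std_normal_distribution t" for t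
    by (simp add: char_def integral_distr)
  then show ?thesis unfolding conv_in_dist_def
    using real_dist_normal_dist by (auto intro!: levy_continuity distr)
qed

section \<open>Monotone random functions at a random point\<close>

text \<open>Replaces a supremum over a possibly uncountable set by one along an increasing sequence,
  so that monotone convergence applies. Without a greatest element, running maxima of points of
  \<open>C\<close> picked above rationals are cofinal.\<close>

lemma exists_cofinal_incseq:
  fixes C :: "real set"
  assumes "C \<noteq> {}"
  obtains s :: "nat \<Rightarrow> real" where "incseq s" "range s \<subseteq> C" "\<And>x. x \<in> C \<Longrightarrow> \<exists>k. x \<le> s k"
proof (cases "\<exists>m\<in>C. \<forall>x\<in>C. x \<le> m")
  case True
  then obtain m where "m \<in> C" "\<forall>x\<in>C. x \<le> m" by blast
  then show ?thesis by (intro that[of "\<lambda>_. m"]) (auto simp: incseq_def)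
next
  case False
  obtain c where c: "c \<in> C" using assms by blast
  \<comment> \<open>A point of \<open>C\<close> above the \<open>j\<close>-th rational if there is
    one, with the fixed element \<open>c\<close> as default so that \<open>u j\<close> always lies
    in \<open>C\<close>.\<close>
  define u where "u j = (if \<exists>x\<in>C. of_rat (nat_to_rat_surj j) \<le> x
    then SOME x. x \<in> C \<and> of_rat (nat_to_rat_surj j) \<le> x else c)" for j
  have u: "u j \<in> C" for j
    using someI_ex[of "\<lambda>x. x \<in> C \<and> of_rat (nat_to_rat_surj j) \<le> x"] c by (auto simp: u_def)
  have u_ge: "of_rat (nat_to_rat_surj j) \<le> u j" if "x \<in> C" "of_rat (nat_to_rat_surj j) \<le> x" for j x
    using someI_ex[of "\<lambda>x. x \<in> C \<and> of_rat (nat_to_rat_surj j) \<le> x"] that by (auto simp: u_def)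
  show ?thesis
  proof (rule that[of "\<lambda>k. Max (u ` {..k})"])
    show "incseq (\<lambda>k. Max (u ` {..k}))" by (intro monoI Max_mono) auto
    have "Max (u ` {..k}) \<in> C" for k
      by (rule subsetD[OF _ Max_in]) (use u in auto)
    then show "range (\<lambda>k. Max (u ` {..k})) \<subseteq> C" by blast
    fix x assume "x \<in> C"
    \<comment> \<open>As \<open>x\<close> is not a greatest element, a rational fits between
      \<open>x\<close> and a larger point \<open>y\<close> of \<open>C\<close>; the point chosen
      above that rational then dominates \<open>x\<close>.\<close>
    with False obtain y where y: "y \<in> C" "x < y" by (auto simp: not_le)
    then obtain r where r: "x < of_rat r" "of_rat r < y" using of_rat_dense by blast
    obtain j where "r = nat_to_rat_surj j" using surj_nat_to_rat_surj by (metis surjD)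
    with r y have "x \<le> u j" using u_ge[of y j] by simp
    also have "u j \<le> Max (u ` {..j})" by (intro Max_ge) auto
    finally show "\<exists>k. x \<le> Max (u ` {..k})" by blast
  qed
qed

text \<open>In \<open>lim\<close> the argument \<open>T z\<close> is frozen while the sample point
  is integrated out, whereas the conclusion evaluates both at the same sample point. With high
  probability \<open>T\<close> lies in the deterministic set \<open>C\<close> of arguments with
  small mean, and by monotonicity a single variable, the supremum over \<open>C\<close>, dominates
  all values there.\<close>

lemma tendsto_0_at_random_point:
  fixes W :: "nat \<Rightarrow> real \<Rightarrow> 'w \<Rightarrow> ennreal"
  assumes prob: "\<And>n. prob_space (Q n)"
    and meas: "\<And>n \<delta>. 0 \<le> \<delta> \<Longrightarrow> W n \<delta> \<in> borel_measurable (Q n)"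
    and mono: "\<And>n \<delta> \<delta>' \<omega>. 0 \<le> \<delta> \<Longrightarrow> \<delta> \<le> \<delta>' \<Longrightarrow> W n \<delta> \<omega> \<le> W n \<delta>' \<omega>"
    and T: "\<And>z. 0 \<le> T z"
    and lim: "((\<lambda>z. \<integral>\<^sup>+\<omega>. W (fst z) (T z) \<omega> \<partial>Q (fst z)) \<longlongrightarrow> 0) (prob_filter Q)"
  shows "((\<lambda>z. W (fst z) (T z) (snd z)) \<longlongrightarrow> 0) (prob_filter Q)"
proof (rule order_tendstoI)
  fix a :: ennreal assume "a > 0"
  then obtain b where b: "0 < b" "b < a" using dense by blast
  then obtain \<epsilon> :: real where \<epsilon>: "b = ennreal \<epsilon>" "\<epsilon> > 0"
    by (cases b) auto
  show "\<forall>\<^sub>F z in prob_filter Q. W (fst z) (T z) (snd z) < a"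
    unfolding eventually_prob_filter
  proof (intro allI impI)
    fix \<eta> :: real assume "\<eta> > 0"
    \<comment> \<open>Markov's inequality at level \<open>\<epsilon>\<close> turns the bound
      \<open>c\<close> on the mean into a probability of at most \<open>\<eta> / 3\<close>, which
      leaves room for the set \<open>A\<close> of measure below \<open>\<eta> / 2\<close>.\<close>
    define c where "c = \<epsilon> * (\<eta> / 3)"
    have "c > 0" using \<open>\<eta> > 0\<close> \<epsilon> by (simp add: c_def)
    then have "\<forall>\<^sub>F z in prob_filter Q. (\<integral>\<^sup>+\<omega>. W (fst z) (T z) \<omega> \<partial>Q (fst z)) < ennreal c"
      by (intro order_tendstoD[OF lim]) simp
    with \<open>\<eta> > 0\<close> have "\<forall>\<^sub>F n in sequentially. \<exists>A\<in>sets (Q n). measure (Q n) A < \<eta> / 2 \<and>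
        (\<forall>\<omega>\<in>space (Q n) - A. (\<integral>\<^sup>+\<omega>'. W n (T (n, \<omega>)) \<omega>' \<partial>Q n) < ennreal c)"
      unfolding eventually_prob_filter using half_gt_zero by fastforce
    then show "\<forall>\<^sub>F n in sequentially. \<exists>A\<in>sets (Q n). measure (Q n) A < \<eta> \<and>
        (\<forall>\<omega>\<in>space (Q n) - A. W (fst (n, \<omega>)) (T (n, \<omega>)) (snd (n, \<omega>)) < a)"
    proof eventually_elim
      case (elim n)
      interpret Qn: prob_space "Q n" by (rule prob)
      define C where "C = {\<delta>. 0 \<le> \<delta> \<and> (\<integral>\<^sup>+\<omega>. W n \<delta> \<omega> \<partial>Q n) < ennreal c}"
      obtain A where A: "A \<in> sets (Q n)" "measure (Q n) A < \<eta> / 2"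
        "\<And>\<omega>. \<omega> \<in> space (Q n) - A \<Longrightarrow> T (n, \<omega>) \<in> C"
        using elim T by (auto simp: C_def)
      show ?case
      proof (cases "C = {}")
        \<comment> \<open>If \<open>C\<close> is empty, no sample point lies outside
          \<open>A\<close>.\<close>
        case True
        with A \<open>\<eta> > 0\<close> show ?thesis by (intro bexI[of _ A]) auto
      next
        case False
        \<comment> \<open>\<open>C\<close> need not contain its supremum, hence the cofinal sequence.\<close>
        obtain s where s: "incseq s" "range s \<subseteq> C" "\<And>x. x \<in> C \<Longrightarrow> \<exists>k. x \<le> s k"
          using exists_cofinal_incseq[OF False] by metis
        have s_nonneg: "0 \<le> s k" and s_int: "(\<integral>\<^sup>+\<omega>. W n (s k) \<omega> \<partial>Q n) < ennreal c" for k
          using s(2) by (auto simp: C_def)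
        have [measurable]: "W n (s k) \<in> borel_measurable (Q n)" for k
          using meas s_nonneg by blast
        \<comment> \<open>The event that the supremum is at least \<open>\<epsilon>\<close>, in the
          form used by \<open>nn_integral_Markov_inequality\<close>.\<close>
        let ?B = "{\<omega>\<in>space (Q n). 1 \<le> ennreal (1 / \<epsilon>) * (SUP k. W n (s k) \<omega>)}"
        have [measurable]: "?B \<in> sets (Q n)" by measurable
        have "emeasure (Q n) ?B \<le> ennreal (1 / \<epsilon>) * (\<integral>\<^sup>+\<omega>. (SUP k. W n (s k) \<omega>) \<partial>Q n)"
          using nn_integral_Markov_inequality[of "\<lambda>\<omega>. SUP k. W n (s k) \<omega>" "space (Q n)" "Q n" "ennreal (1 / \<epsilon>)"]
          by (simp cong: nn_integral_cong)
        also have "(\<integral>\<^sup>+\<omega>. (SUP k. W n (s k) \<omega>) \<partial>Q n) = (SUP k. \<integral>\<^sup>+\<omega>. W n (s k) \<omega> \<partial>Q n)"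
          using s(1) s_nonneg mono by (intro nn_integral_monotone_convergence_SUP)
            (auto simp: incseq_def le_fun_def)
        also have "ennreal (1 / \<epsilon>) * \<dots> \<le> ennreal (1 / \<epsilon>) * ennreal c"
          using s_int by (intro mult_left_mono SUP_least) (auto intro: less_imp_le)
        also have "\<dots> = ennreal (\<eta> / 3)"
          using \<epsilon> \<open>\<eta> > 0\<close> \<open>c > 0\<close> by (simp add: c_def flip: ennreal_mult)
        finally have "measure (Q n) ?B \<le> \<eta> / 3"
          using \<open>\<eta> > 0\<close> by (simp add: Qn.emeasure_eq_measure)
        then have "measure (Q n) (A \<union> ?B) < \<eta>"
          using A measure_Un_le[of A "Q n" ?B] \<open>\<eta> > 0\<close> by auto
        moreover have "W n (T (n, \<omega>)) \<omega> < a" if \<omega>: "\<omega> \<in> space (Q n) - (A \<union> ?B)" for \<omega>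
        proof -
          obtain k where k: "T (n, \<omega>) \<le> s k" using s(3) A(3) \<omega> by blast
          have "W n (T (n, \<omega>)) \<omega> \<le> (SUP k. W n (s k) \<omega>)"
            using mono[OF T k] by (auto intro: SUP_upper2)
          also have "\<dots> \<le> ennreal \<epsilon>"
          proof (rule ccontr)
            assume "\<not> (SUP k. W n (s k) \<omega>) \<le> ennreal \<epsilon>"
            then have "ennreal (1 / \<epsilon>) * ennreal \<epsilon> \<le> ennreal (1 / \<epsilon>) * (SUP k. W n (s k) \<omega>)"
              by (intro mult_left_mono) auto
            with \<epsilon> \<omega> show False by (auto simp flip: ennreal_mult)
          qed
          finally show ?thesis using b \<epsilon> by simp
        qed
        ultimately show ?thesis using A(1) by (intro bexI[of _ "A \<union> ?B"]) auto
      qed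
    qed
  qed
qed simp

section \<open>Measurability of a continuous process at a random point\<close>

text \<open>Rounding \<open>T\<close> down to multiples of \<open>1 / 2 ^ k\<close> leaves countably
  many arguments, where measurability at fixed \<open>t\<close> suffices. Path continuity gives the
  limit in \<open>k\<close>, and completeness absorbs the null set of discontinuous paths.\<close>

lemma borel_measurable_random_argument:
  fixes m :: "real \<Rightarrow> 'w \<Rightarrow> real"
  assumes "complete_measure Q" and "open \<Theta>"
    and m: "\<And>t. t \<in> \<Theta> \<Longrightarrow> m t \<in> borel_measurable Q"
    and T[measurable]: "T \<in> borel_measurable Q"
    and cont: "AE \<omega> in Q. continuous_on \<Theta> (\<lambda>t. m t \<omega>)"
  shows "(\<lambda>\<omega>. if T \<omega> \<in> \<Theta> then m (T \<omega>) \<omega> else 0) \<in> borel_measurable Q"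
proof -
  interpret complete_measure Q by fact
  have [measurable]: "\<Theta> \<in> sets borel" using \<open>open \<Theta>\<close> by simp
  define r where "r k x = real_of_int \<lfloor>2 ^ k * x\<rfloor> / 2 ^ k" for k :: nat and x :: real
  \<comment> \<open>The rounded point may leave \<open>\<Theta>\<close>, in which case the value is
    0; as \<open>\<Theta>\<close> is open, this stops for large \<open>k\<close> whenever
    \<open>T \<omega>\<close> is in \<open>\<Theta>\<close>.\<close>
  define A where "A k \<omega> = (if T \<omega> \<in> \<Theta> \<and> r k (T \<omega>) \<in> \<Theta> then m (r k (T \<omega>)) \<omega> else 0)" for k \<omega>
  have A[measurable]: "A k \<in> borel_measurable Q" for k
  proof -
    define f where "f j \<omega> = (if T \<omega> \<in> \<Theta> \<and> real_of_int j / 2 ^ k \<in> \<Theta>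
      then m (real_of_int j / 2 ^ k) \<omega> else 0)" for j \<omega>
    have "f j \<in> borel_measurable Q" for j
    proof (cases "real_of_int j / 2 ^ k \<in> \<Theta>")
      case True
      from m[OF this, measurable] True show ?thesis by (simp add: f_def[abs_def]) measurable
    qed (simp add: f_def[abs_def])
    then have "(\<lambda>\<omega>. f \<lfloor>2 ^ k * T \<omega>\<rfloor> \<omega>) \<in> borel_measurable Q"
      by (rule measurable_compose_countable) measurable
    then show ?thesis by (simp add: A_def[abs_def] f_def r_def cong: if_cong)
  qed
  have r: "(\<lambda>k. r k x) \<longlonglongrightarrow> x" for x
  proof -
    have "\<bar>r k x - x\<bar> \<le> (1 / 2) ^ k" for k
    proof -
      have "r k x - x = (real_of_int \<lfloor>2 ^ k * x\<rfloor> - 2 ^ k * x) / 2 ^ k" by (simp add: r_def field_simps)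
      also have "\<bar>\<dots>\<bar> = \<bar>real_of_int \<lfloor>2 ^ k * x\<rfloor> - 2 ^ k * x\<bar> / 2 ^ k" by (simp add: abs_divide)
      also have "\<dots> \<le> 1 / 2 ^ k" by (rule divide_right_mono) (linarith, simp)
      finally show ?thesis by (simp add: power_divide)
    qed
    then have "(\<lambda>k. r k x - x) \<longlonglongrightarrow> 0"
      by (intro Lim_null_comparison[OF _ LIMSEQ_realpow_zero[of "1 / 2"]]) auto
    then show ?thesis by (simp add: LIM_zero_iff)
  qed
  have lim: "(\<lambda>k. A k \<omega>) \<longlonglongrightarrow> (if T \<omega> \<in> \<Theta> then m (T \<omega>) \<omega> else 0)"
    if c: "continuous_on \<Theta> (\<lambda>t. m t \<omega>)" for \<omega>
  proof (cases "T \<omega> \<in> \<Theta>")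
    case True
    then have "isCont (\<lambda>t. m t \<omega>) (T \<omega>)"
      using c \<open>open \<Theta>\<close> continuous_on_eq_continuous_at by blast
    then have "(\<lambda>k. m (r k (T \<omega>)) \<omega>) \<longlonglongrightarrow> m (T \<omega>) \<omega>"
      by (rule isCont_tendsto_compose) (rule r)
    moreover have "\<forall>\<^sub>F k in sequentially. m (r k (T \<omega>)) \<omega> = A k \<omega>"
      using topological_tendstoD[OF r \<open>open \<Theta>\<close> True] by eventually_elim (simp add: A_def True)
    ultimately show ?thesis using True by (simp add: tendsto_cong)
  qed (simp add: A_def)
  obtain N where N: "\<And>\<omega>. \<omega> \<in> space Q - N \<Longrightarrow> continuous_on \<Theta> (\<lambda>t. m t \<omega>)" "N \<in> null_sets Q"
    by (rule AE_E3[OF cont]) (rule that)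
  have [measurable]: "N \<in> sets Q" using N by auto
  define g where "g \<omega> = (if T \<omega> \<in> \<Theta> then m (T \<omega>) \<omega> else 0)" for \<omega>
  \<comment> \<open>Zeroing on \<open>N\<close> gives convergence at every sample point;
    \<open>g\<close> itself differs from this limit only on a null set.\<close>
  have "(\<lambda>\<omega>. if \<omega> \<in> N then 0 else g \<omega>) \<in> borel_measurable Q"
  proof (rule borel_measurable_LIMSEQ_real)
    show "(\<lambda>\<omega>. if \<omega> \<in> N then 0 else A k \<omega>) \<in> borel_measurable Q" for k by measurable
    show "(\<lambda>k. if \<omega> \<in> N then 0 else A k \<omega>) \<longlonglongrightarrow> (if \<omega> \<in> N then 0 else g \<omega>)" if "\<omega> \<in> space Q" for \<omega>
      using N that lim[of \<omega>] by (cases "\<omega> \<in> N") (auto simp: g_def)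
  qed
  note g' = measurable_sets[OF this]
  have "g \<in> borel_measurable Q"
  proof (rule measurableI)
    fix B :: "real set" assume B: "B \<in> sets borel"
    show "g -` B \<inter> space Q \<in> sets Q"
    proof (rule in_sets_AE[OF _ g'[OF B]])
      show "AE \<omega> in Q. (\<omega> \<in> (\<lambda>\<omega>. if \<omega> \<in> N then 0 else g \<omega>) -` B \<inter> space Q) = (\<omega> \<in> g -` B \<inter> space Q)"
        using AE_not_in[OF N(2)] by eventually_elim auto
    qed auto
  qed auto
  then show ?thesis by (simp add: g_def[abs_def])
qed

section \<open>The remainder of the expansion at the true parameter\<close>

text \<open>Near each point of \<open>\<Theta>\<close>, \<open>f\<close> is a constant plus an
  indefinite integral. This supplies the continuous paths required for plugging in a random
  argument.\<close>

lemma continuous_on_of_integral: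
  fixes f f' :: "real \<Rightarrow> real"
  assumes "open \<Theta>"
    and "\<And>t1 t2. t1 \<le> t2 \<Longrightarrow> {t1..t2} \<subseteq> \<Theta> \<Longrightarrow> set_integrable lebesgue {t1..t2} f' \<and>
      f t2 - f t1 = (LINT t:{t1..t2}|lebesgue. f' t)"
  shows "continuous_on \<Theta> f"
proof (rule continuous_at_imp_continuous_on, rule ballI)
  fix x assume "x \<in> \<Theta>"
  with \<open>open \<Theta>\<close> obtain e where e: "e > 0" "cball x e \<subseteq> \<Theta>" using open_contains_cball by blast
  then have sub: "{x - e..x + e} \<subseteq> \<Theta>" by (simp add: cball_eq_atLeastAtMost)
  have "f' integrable_on {x - e..x + e}"
    using assms(2)[OF _ sub] e set_lebesgue_integral_eq_integral(1) by auto
  then have "continuous_on {x - e..x + e} (\<lambda>y. f (x - e) + integral {x - e..y} f')"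
    by (intro continuous_intros indefinite_integral_continuous_1)
  moreover have "f (x - e) + integral {x - e..y} f' = f y" if "y \<in> {x - e..x + e}" for y
  proof -
    have "{x - e..y} \<subseteq> \<Theta>" using sub that by (auto simp: subset_iff)
    then show ?thesis using assms(2)[of "x - e" y] that
      by (auto simp: set_lebesgue_integral_eq_integral(2))
  qed
  ultimately have "continuous_on {x - e..x + e} f" 
    by (subst (asm) continuous_on_cong[OF refl, where g = f]) auto
  then have "continuous_on {x - e<..<x + e} f" by (rule continuous_on_subset) auto
  then show "isCont f x" using e by (subst (asm) continuous_on_eq_continuous_at) auto
qed

text \<open>The remainder is the integral of \<open>m' t x - m' \<theta> x\<close> between
  \<open>\<theta>\<close> and \<open>\<theta> + h\<close>, and the integrand is at most
  \<open>tau\<close> in absolute value.\<close>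

lemma tau_remainder:
  assumes int: "\<And>t1 t2. t1 \<le> t2 \<Longrightarrow> {t1..t2} \<subseteq> \<Theta> \<Longrightarrow>
      set_integrable lebesgue {t1..t2} (\<lambda>t. m' t x) \<and>
      m t2 x - m t1 x = (LINT t:{t1..t2}|lebesgue. m' t x)"
    and sub: "{\<theta> - \<bar>h\<bar>..\<theta> + \<bar>h\<bar>} \<subseteq> \<Theta>"
  shows "ennreal \<bar>m (\<theta> + h) x - m \<theta> x - h * m' \<theta> x\<bar> \<le> ennreal \<bar>h\<bar> * tau \<Theta> m' \<theta> \<bar>h\<bar> x"
\<comment> \<open>\<open>h = 0\<close> makes the left side vanish; otherwise an infinite
  \<open>tau\<close> makes the right side infinite. What remains has a real bound
  \<open>c\<close>.\<close>
proof (cases "h = 0 \<or> tau \<Theta> m' \<theta> \<bar>h\<bar> x = \<top>")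
  case True
  then show ?thesis by (auto simp: ennreal_mult_top)
next
  case False
  then obtain c where c: "tau \<Theta> m' \<theta> \<bar>h\<bar> x = ennreal c" "c \<ge> 0"
    by (cases "tau \<Theta> m' \<theta> \<bar>h\<bar> x") auto
  have bound: "\<bar>m' t x - m' \<theta> x\<bar> \<le> c" if "\<bar>t - \<theta>\<bar> \<le> \<bar>h\<bar>" for t
  proof -
    have "ennreal \<bar>m' t x - m' \<theta> x\<bar> \<le> tau \<Theta> m' \<theta> \<bar>h\<bar> x"
      using sub that unfolding tau_def by (auto intro!: SUP_upper)
    with c show ?thesis by simp
  qed
  \<comment> \<open>Stated for ordered endpoints so that it serves both signs of \<open>h\<close>,
    with \<open>\<theta>\<close> as the left or as the right endpoint.\<close>
  have rem: "\<bar>m b x - m a x - (b - a) * m' \<theta> x\<bar> \<le> c * (b - a)"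
    if ab: "a \<le> b" "{a..b} \<subseteq> {\<theta> - \<bar>h\<bar>..\<theta> + \<bar>h\<bar>}" for a b
  proof -
    have "{a..b} \<subseteq> \<Theta>" using ab(2) sub by (rule subset_trans)
    note I = int[OF ab(1) this]
    have intg: "(\<lambda>t. m' t x) integrable_on {a..b}"
      using I set_lebesgue_integral_eq_integral(1) by blast
    have "m b x - m a x = integral {a..b} (\<lambda>t. m' t x)"
      using I set_lebesgue_integral_eq_integral(2) by metis
    also have "\<dots> = integral {a..b} (\<lambda>t. m' t x - m' \<theta> x) + integral {a..b} (\<lambda>t. m' \<theta> x)"
      using intg by (subst Henstock_Kurzweil_Integration.integral_diff) (auto simp: integrable_const_ivl)
    finally have "m b x - m a x - (b - a) * m' \<theta> x = integral (cbox a b) (\<lambda>t. m' t x - m' \<theta> x)"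
      using ab by simp
    also have "norm \<dots> \<le> c * measure lborel (cbox a b)"
    proof (rule integrable_bound[OF c(2)])
      show "(\<lambda>t. m' t x - m' \<theta> x) integrable_on cbox a b"
        using intg by (auto intro!: Henstock_Kurzweil_Integration.integrable_diff integrable_const_ivl)
      show "norm (m' t x - m' \<theta> x) \<le> c" if "t \<in> cbox a b" for t
        using bound[of t] that ab(2) by (auto simp: subset_iff abs_le_iff)
    qed
    finally show ?thesis using ab by simp
  qed
  have "\<bar>m (\<theta> + h) x - m \<theta> x - h * m' \<theta> x\<bar> \<le> c * \<bar>h\<bar>"
    using rem[of \<theta> "\<theta> + h"] rem[of "\<theta> + h" \<theta>] by (cases "h \<ge> 0") (auto simp: abs_if split: if_splits)
  then have "ennreal \<bar>m (\<theta> + h) x - m \<theta> x - h * m' \<theta> x\<bar> \<le> ennreal (\<bar>h\<bar> * c)"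
    by (intro ennreal_leI) (simp add: mult.commute)
  then show ?thesis using c by (simp add: ennreal_mult)
qed

text \<open>The value \<open>\<top>\<close> assigned once the interval leaves
  \<open>\<Theta>\<close> keeps \<open>tau\<close> monotone, as the passage to a random argument
  demands.\<close>

lemma tau_mono: "\<delta> \<le> \<delta>' \<Longrightarrow> tau \<Theta> m' \<theta> \<delta> x \<le> tau \<Theta> m' \<theta> \<delta>' x"
proof (cases "{\<theta> - \<delta>'..\<theta> + \<delta>'} \<subseteq> \<Theta>")
  case True
  assume "\<delta> \<le> \<delta>'"
  then have "{\<theta> - \<delta>..\<theta> + \<delta>} \<subseteq> {\<theta> - \<delta>'..\<theta> + \<delta>'}" by auto
  with True \<open>\<delta> \<le> \<delta>'\<close> show ?thesis unfolding tau_def by (auto intro!: SUP_subset_mono)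
qed (simp add: tau_def)

text \<open>Used with \<open>j = \<bar>J n\<bar>\<close>: the quotient on the right is then the
  random variable whose mean is \<open>tau_bar\<close>.\<close>

lemma sum_tau_remainder:
  assumes int: "\<And>i t1 t2. i \<in> A \<Longrightarrow> t1 \<le> t2 \<Longrightarrow> {t1..t2} \<subseteq> \<Theta> \<Longrightarrow>
      set_integrable lebesgue {t1..t2} (\<lambda>t. m' i t (x i)) \<and>
      m i t2 (x i) - m i t1 (x i) = (LINT t:{t1..t2}|lebesgue. m' i t (x i))"
    and sub: "{\<theta> - \<bar>h\<bar>..\<theta> + \<bar>h\<bar>} \<subseteq> \<Theta>" and "j > 0"
  shows "ennreal ((\<Sum>i\<in>A. \<bar>m i (\<theta> + h) (x i) - m i \<theta> (x i) - h * m' i \<theta> (x i)\<bar>) / j)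
    \<le> ennreal \<bar>h\<bar> * ((\<Sum>i\<in>A. tau \<Theta> (m' i) \<theta> \<bar>h\<bar> (x i)) / ennreal j)"
proof -
  have "ennreal (\<Sum>i\<in>A. \<bar>m i (\<theta> + h) (x i) - m i \<theta> (x i) - h * m' i \<theta> (x i)\<bar>) =
      (\<Sum>i\<in>A. ennreal \<bar>m i (\<theta> + h) (x i) - m i \<theta> (x i) - h * m' i \<theta> (x i)\<bar>)"
    by simp
  also have "\<dots> \<le> (\<Sum>i\<in>A. ennreal \<bar>h\<bar> * tau \<Theta> (m' i) \<theta> \<bar>h\<bar> (x i))"
    using int sub by (intro sum_mono tau_remainder) auto
  also have "\<dots> = ennreal \<bar>h\<bar> * (\<Sum>i\<in>A. tau \<Theta> (m' i) \<theta> \<bar>h\<bar> (x i))"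
    by (simp add: sum_distrib_left)
  finally show ?thesis
    using \<open>j > 0\<close> by (simp add: ennreal_times_divide sum_nonneg divide_right_mono_ennreal flip: divide_ennreal)
qed

text \<open>Minkowski's inequality for \<open>f - g\<close> written as \<open>h * k\<close> plus a
  remainder, the Euclidean norm of the remainder being at most the sum of its absolute
  values.\<close>

lemma L2_set_diff_le:
  "\<bar>L2_set f A - L2_set g A\<bar> \<le> \<bar>h\<bar> * L2_set k A + (\<Sum>i\<in>A. \<bar>f i - g i - h * k i\<bar>)"
proof -
  define d where "d i = f i - g i" for i
  have "L2_set d A \<le> L2_set (\<lambda>i. h * k i) A + L2_set (\<lambda>i. d i - h * k i) A"
    using L2_set_triangle_ineq[of "\<lambda>i. h * k i" "\<lambda>i. d i - h * k i" A] by simp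
  also have "L2_set (\<lambda>i. h * k i) A = L2_set (\<lambda>i. \<bar>h\<bar> * k i) A"
    by (simp add: L2_set_def power_mult_distrib)
  also have "\<dots> = \<bar>h\<bar> * L2_set k A"
    by (simp add: L2_set_right_distrib)
  also have "L2_set (\<lambda>i. d i - h * k i) A \<le> (\<Sum>i\<in>A. \<bar>d i - h * k i\<bar>)"
    by (rule L2_set_le_sum_abs)
  finally have d: "L2_set d A \<le> \<bar>h\<bar> * L2_set k A + (\<Sum>i\<in>A. \<bar>d i - h * k i\<bar>)" by simp
  have "L2_set f A \<le> L2_set g A + L2_set d A"
    using L2_set_triangle_ineq[of g d A] by (simp add: d_def)
  moreover have "L2_set g A \<le> L2_set f A + L2_set d A"
  proof -
    have "L2_set (\<lambda>i. - d i) A = L2_set d A" by (simp add: L2_set_def)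
    then show ?thesis using L2_set_triangle_ineq[of f "\<lambda>i. - d i" A] by (simp add: d_def)
  qed
  ultimately show ?thesis using d by (simp add: d_def)
qed

lemma tendsto_0_sandwich_abs:
  fixes f g :: "'a \<Rightarrow> real"
  assumes "(g \<longlongrightarrow> 0) F" and "\<forall>\<^sub>F z in F. \<bar>f z\<bar> \<le> g z"
  shows "(f \<longlongrightarrow> 0) F"
  using assms by (intro Lim_null_comparison[of f g]) auto

section \<open>One-step estimators\<close>

text \<open>Completion does not alter the measure of a measurable set, so hypotheses on
  \<open>P n\<close> transfer to the completed spaces on which the plug-in statistics are
  measurable.\<close>

lemma conv_in_prob_completion:
  "conv_in_prob P Y c \<Longrightarrow> conv_in_prob (\<lambda>n. completion (P n)) Y c"
proof -
  assume Y: "conv_in_prob P Y c"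
  then have [measurable]: "Y n \<in> borel_measurable (P n)" for n
    by (simp add: conv_in_prob_def)
  have "{\<omega> \<in> space (P n). \<epsilon> < \<bar>Y n \<omega> - c\<bar>} \<in> sets (P n)" for n \<epsilon>
    by measurable
  with Y show ?thesis
    by (simp add: conv_in_prob_def measurable_completion)
qed

lemma conv_in_prob_0_completion:
  "conv_in_prob_0 P Y \<Longrightarrow> conv_in_prob_0 (\<lambda>n. completion (P n)) Y"
proof -
  assume Y: "conv_in_prob_0 P Y"
  then have [measurable]: "Y n \<in> borel_measurable (P n)" for n
    by (simp add: conv_in_prob_0_def)
  have "{\<omega> \<in> space (P n). ennreal \<epsilon> < Y n \<omega>} \<in> sets (P n)" for n \<epsilon>
    by measurable
  with Y show ?thesis
    by (simp add: conv_in_prob_0_def measurable_completion)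
qed

lemma conv_in_dist_completion:
  "conv_in_dist P Y \<mu> \<Longrightarrow> conv_in_dist (\<lambda>n. completion (P n)) Y \<mu>"
  by (auto simp: conv_in_dist_def measurable_completion distr_completion)

theorem mainTheorem4:
  fixes P :: "nat \<Rightarrow> 'w measure"
    and S :: "nat \<Rightarrow> 'x measure"
    and X :: "nat \<Rightarrow> nat \<Rightarrow> 'w \<Rightarrow> 'x"
    and M M' :: "nat \<Rightarrow> nat \<Rightarrow> real \<Rightarrow> 'x \<Rightarrow> real"
    and \<Theta> :: "real set" and \<theta> :: real
    and Tstar Jstar :: "nat \<Rightarrow> (nat \<Rightarrow> 'x) \<Rightarrow> real"
  defines "I \<equiv> I_sum P X M \<theta>"
    and "J \<equiv> J_sum P X M' \<theta>"
    and "\<tau>bar \<equiv> tau_bar P X \<Theta> M' \<theta>"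
    and "\<theta>s \<equiv> \<lambda>n \<omega>. Tstar n (sample X n \<omega>)"
    and "Js \<equiv> \<lambda>n \<omega>. Jstar n (sample X n \<omega>)"
    and "\<theta>ss \<equiv> \<lambda>n \<omega>. one_step \<Theta> M Tstar Jstar n (sample X n \<omega>)"
    and "ds \<equiv> \<lambda>n \<omega>. d_stat \<Theta> M Tstar Jstar n (sample X n \<omega>)"
    (* completions: theta-star is plugged into functions that are only measurable in x
       for fixed t and continuous in t almost surely *)
    and "Pc \<equiv> \<lambda>n. completion (P n)"
  assumes prob: "\<And>n. prob_space (P n)"
    and indep: "\<And>n. prob_space.indep_vars (P n) (\<lambda>_. S n) (X n) {1..n}"
    and Theta: "open \<Theta>" "\<theta> \<in> \<Theta>"
    (* the random quantities in the formulation are random variables *)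
    and M_meas: "\<And>n i t. \<lbrakk>i \<in> {1..n}; t \<in> \<Theta>\<rbrakk> \<Longrightarrow> M n i t \<in> borel_measurable (S n)"
    and tau_meas: "\<And>n i \<delta>. \<lbrakk>i \<in> {1..n}; 0 \<le> \<delta>\<rbrakk> \<Longrightarrow>
          (\<lambda>\<omega>. tau \<Theta> (M' n i) \<theta> \<delta> (X n i \<omega>)) \<in> borel_measurable (P n)"
    and Tstar_stat: "\<And>n. Tstar n \<in> borel_measurable (PiM {1..n} (\<lambda>_. S n))"
    and Jstar_stat: "\<And>n. Jstar n \<in> borel_measurable (PiM {1..n} (\<lambda>_. S n))"
    (* (a) *)
    and a_int: "\<And>n i. i \<in> {1..n} \<Longrightarrow>
          AE \<omega> in P n. \<forall>t1 t2. t1 \<le> t2 \<and> {t1..t2} \<subseteq> \<Theta> \<longrightarrow>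
            set_integrable lebesgue {t1..t2} (\<lambda>t. M' n i t (X n i \<omega>)) \<and>
            M n i t2 (X n i \<omega>) - M n i t1 (X n i \<omega>) = (LINT t:{t1..t2}|lebesgue. M' n i t (X n i \<omega>))"
    and a_sq: "\<And>n i. i \<in> {1..n} \<Longrightarrow> integrable (P n) (\<lambda>\<omega>. (M n i \<theta> (X n i \<omega>))\<^sup>2)"
    and a_mean: "\<And>n i. i \<in> {1..n} \<Longrightarrow> (\<integral>\<omega>. M n i \<theta> (X n i \<omega>) \<partial>P n) = 0"
    and a_deriv: "\<And>n i. i \<in> {1..n} \<Longrightarrow> integrable (P n) (\<lambda>\<omega>. M' n i \<theta> (X n i \<omega>))"
    (* (b) *)
    and b_pos: "\<forall>\<^sub>F n in sequentially. I n > 0 \<and> J n \<noteq> 0"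
    and b_rate: "filterlim (\<lambda>n. \<bar>J n\<bar> / sqrt (I n)) at_top sequentially"
    and b_lln: "conv_in_prob P (\<lambda>n \<omega>. (\<Sum>i=1..n. M' n i \<theta> (X n i \<omega>)) / J n) 1"
    and b_clt: "conv_in_dist P (\<lambda>n \<omega>. (\<Sum>i=1..n. M n i \<theta> (X n i \<omega>)) / sqrt (I n)) std_normal_distribution"
    (* (c) *)
    and c: "((\<lambda>\<delta>. limsup (\<lambda>n. \<tau>bar n \<delta>)) \<longlongrightarrow> 0) (at_right 0)"
    (* (d) *)
    and d: "conv_in_prob_0 P (\<lambda>n \<omega>. ennreal (\<bar>J n\<bar> / sqrt (I n) * \<bar>\<theta>s n \<omega> - \<theta>\<bar>) * \<tau>bar n \<bar>\<theta>s n \<omega> - \<theta>\<bar>)"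
    (* (e) *)
    and e_rate: "conv_in_prob P (\<lambda>n \<omega>. \<bar>J n\<bar> / sqrt (I n) * \<bar>\<theta>s n \<omega> - \<theta>\<bar> *
          (\<bar>Js n \<omega> / J n - 1\<bar> + \<bar>(\<Sum>i=1..n. M' n i \<theta> (X n i \<omega>)) / J n - 1\<bar>)) 0"
    and e_cons: "conv_in_prob P (\<lambda>n \<omega>. Js n \<omega> / J n) 1"
  shows "defined_wpt1 Pc (\<lambda>n \<omega>. one_step_defined \<Theta> Tstar Jstar n (sample X n \<omega>)) \<and>
         conv_in_dist Pc (\<lambda>n \<omega>. J n / sqrt (I n) * (\<theta>ss n \<omega> - \<theta>)) std_normal_distribution \<and>
         (conv_in_prob P (\<lambda>n \<omega>. (\<Sum>i=1..n. (M' n i \<theta> (X n i \<omega>))\<^sup>2) / (J n)\<^sup>2) 0 \<and>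
          conv_in_prob P (\<lambda>n \<omega>. (\<Sum>i=1..n. (M n i \<theta> (X n i \<omega>))\<^sup>2) / I n) 1 \<longrightarrow>
            defined_wpt1 Pc (\<lambda>n \<omega>. d_stat_defined \<Theta> M Tstar Jstar n (sample X n \<omega>)) \<and>
            conv_in_dist Pc (\<lambda>n \<omega>. ds n \<omega> * (\<theta>ss n \<omega> - \<theta>)) std_normal_distribution)"
proof -

  \<comment> \<open>Completed spaces and measurability of the statistics\<close>
  define F where "F = prob_filter Pc"
  have Pc_prob: "prob_space (Pc n)" for n
    by (rule prob_spaceI) (simp add: Pc_def prob_space.emeasure_space_1[OF prob])
  have Pc_complete: "complete_measure (Pc n)" for n
    unfolding Pc_def by (rule completion.complete_measure_axioms)

  have X: "X n i \<in> measurable (P n) (S n)" if "i \<in> {1..n}" for n i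
    using indep[of n] that by (simp add: prob_space.indep_vars_def2[OF prob])
  have sample: "sample X n \<in> measurable (P n) (PiM {1..n} (\<lambda>_. S n))" for n
    unfolding sample_def[abs_def] by (intro measurable_restrict X)
  have \<theta>s[measurable]: "\<theta>s n \<in> borel_measurable (Pc n)" for n
    using measurable_compose[OF sample Tstar_stat] by (simp add: \<theta>s_def Pc_def measurable_completion)
  have Js[measurable]: "Js n \<in> borel_measurable (Pc n)" for n
    using measurable_compose[OF sample Jstar_stat] by (simp add: Js_def Pc_def measurable_completion)
  have [measurable]: "\<Theta> \<in> sets borel" using Theta by simp
  have MX: "(\<lambda>\<omega>. M n i t (X n i \<omega>)) \<in> borel_measurable (Pc n)" if "i \<in> {1..n}" "t \<in> \<Theta>" for n i t
    using measurable_compose[OF X[OF that(1)] M_meas[OF that]] by (simp add: Pc_def measurable_completion)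
  have tauX: "(\<lambda>\<omega>. tau \<Theta> (M' n i) \<theta> \<delta> (X n i \<omega>)) \<in> borel_measurable (Pc n)"
    if "i \<in> {1..n}" "0 \<le> \<delta>" for n i \<delta>
    using tau_meas[OF that] by (simp add: Pc_def measurable_completion)

  \<comment> \<open>The integral identity of (a) for all \<open>i\<close> of row \<open>n\<close> at
    once; it is almost sure because the row is finite.\<close>
  define reg where "reg n \<omega> \<longleftrightarrow> (\<forall>i\<in>{1..n}. \<forall>t1 t2. t1 \<le> t2 \<and> {t1..t2} \<subseteq> \<Theta> \<longrightarrow>
      set_integrable lebesgue {t1..t2} (\<lambda>t. M' n i t (X n i \<omega>)) \<and>
      M n i t2 (X n i \<omega>) - M n i t1 (X n i \<omega>) = (LINT t:{t1..t2}|lebesgue. M' n i t (X n i \<omega>)))" for n \<omega>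
  have reg_AE: "AE \<omega> in Pc n. reg n \<omega>" for n
    unfolding reg_def Pc_def by (intro AE_completion AE_finite_allI) (use a_int in auto)
  have reg: "\<forall>\<^sub>F z in F. reg (fst z) (snd z)"
    unfolding F_def by (rule eventually_prob_filterI_AE) (use reg_AE in simp)
  have M_random: "(\<lambda>\<omega>. if T \<omega> \<in> \<Theta> then M n i (T \<omega>) (X n i \<omega>) else 0) \<in> borel_measurable (Pc n)"
    if i: "i \<in> {1..n}" and T: "T \<in> borel_measurable (Pc n)" for n i T
  proof (rule borel_measurable_random_argument[OF Pc_complete Theta(1) MX[OF i] T])
    show "AE \<omega> in Pc n. continuous_on \<Theta> (\<lambda>t. M n i t (X n i \<omega>))"
      using reg_AE[of n]
    proof eventually_elim
      case (elim \<omega>)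
      show ?case
        by (rule continuous_on_of_integral[OF Theta(1), of "\<lambda>t. M' n i t (X n i \<omega>)"])
          (use elim i in \<open>auto simp: reg_def\<close>)
    qed
  qed

  have osd_iff: "one_step_defined \<Theta> Tstar Jstar n (sample X n \<omega>) \<longleftrightarrow> \<theta>s n \<omega> \<in> \<Theta> \<and> Js n \<omega> \<noteq> 0" for n \<omega>
    by (simp add: one_step_defined_def \<theta>s_def Js_def)
  have sum_sample: "(\<Sum>i=1..n. f i (sample X n \<omega> i)) = (\<Sum>i=1..n. f i (X n i \<omega>))"
    for f :: "nat \<Rightarrow> 'x \<Rightarrow> real" and n \<omega>
    by (intro sum.cong) (auto simp: sample_def)
  have \<theta>ss_eq: "\<theta>ss n \<omega> = (if \<theta>s n \<omega> \<in> \<Theta> \<and> Js n \<omega> \<noteq> 0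
      then \<theta>s n \<omega> - (\<Sum>i=1..n. M n i (\<theta>s n \<omega>) (X n i \<omega>)) / Js n \<omega> else 0)" for n \<omega>
    using sum_sample[of "\<lambda>i. M n i (\<theta>s n \<omega>)"]
    by (simp add: \<theta>ss_def one_step_def osd_iff) (simp add: \<theta>s_def Js_def)
  have \<theta>ss[measurable]: "\<theta>ss n \<in> borel_measurable (Pc n)" for n
  proof -
    \<comment> \<open>The guard inside the sum is implied by the outer condition below and brings
      each term into the form covered by \<open>M_random\<close>.\<close>
    have [measurable]: "(\<lambda>\<omega>. \<Sum>i=1..n. if \<theta>s n \<omega> \<in> \<Theta> then M n i (\<theta>s n \<omega>) (X n i \<omega>) else 0)
        \<in> borel_measurable (Pc n)"
      by (intro borel_measurable_sum M_random) auto
    have "(\<lambda>\<omega>. if \<theta>s n \<omega> \<in> \<Theta> \<and> Js n \<omega> \<noteq> 0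
        then \<theta>s n \<omega> - (\<Sum>i=1..n. if \<theta>s n \<omega> \<in> \<Theta> then M n i (\<theta>s n \<omega>) (X n i \<omega>) else 0) / Js n \<omega> else 0)
        \<in> borel_measurable (Pc n)"
      by measurable
    moreover have "\<theta>ss n = (\<lambda>\<omega>. if \<theta>s n \<omega> \<in> \<Theta> \<and> Js n \<omega> \<noteq> 0
        then \<theta>s n \<omega> - (\<Sum>i=1..n. if \<theta>s n \<omega> \<in> \<Theta> then M n i (\<theta>s n \<omega>) (X n i \<omega>) else 0) / Js n \<omega> else 0)"
      by (auto simp: \<theta>ss_eq fun_eq_iff)
    ultimately show ?thesis by simp
  qed

  \<comment> \<open>Normalised errors and the bound on the expansion remainder\<close>
  define R where "R n = \<bar>J n\<bar> / sqrt (I n)" for n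
  define D where "D z = \<theta>s (fst z) (snd z) - \<theta>" for z :: "nat \<times> 'w"
  define Z where "Z n \<omega> = (\<Sum>i=1..n. M n i \<theta> (X n i \<omega>)) / sqrt (I n)" for n \<omega>
  \<comment> \<open>\<open>V n \<delta>\<close> has mean \<open>\<tau>bar n \<delta>\<close>, as
    \<open>V_int\<close> shows, and \<open>rem\<close> is the absolute remainder of the expansion at
    \<open>\<theta>\<close>, summed over the row.\<close>
  define V where "V n \<delta> \<omega> = (\<Sum>i=1..n. tau \<Theta> (M' n i) \<theta> \<delta> (X n i \<omega>)) / ennreal \<bar>J n\<bar>" for n \<delta> \<omega>
  define rem where "rem n h \<omega> =
    (\<Sum>i=1..n. \<bar>M n i (\<theta> + h) (X n i \<omega>) - M n i \<theta> (X n i \<omega>) - h * M' n i \<theta> (X n i \<omega>)\<bar>)" for n h \<omega>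
  have pos: "\<forall>\<^sub>F z in F. I (fst z) > 0 \<and> J (fst z) \<noteq> 0"
    unfolding F_def using b_pos by (rule eventually_prob_filterI_fst)

  have V_meas: "V n \<delta> \<in> borel_measurable (Pc n)" if "0 \<le> \<delta>" for n \<delta>
    unfolding V_def[abs_def] using that tauX by (intro borel_measurable_divide_ennreal borel_measurable_sum) auto
  have V_mono: "V n \<delta> \<omega> \<le> V n \<delta>' \<omega>" if "\<delta> \<le> \<delta>'" for n \<delta> \<delta>' \<omega>
    unfolding V_def by (intro divide_right_mono_ennreal sum_mono tau_mono that)
  have V_int: "(\<integral>\<^sup>+\<omega>. V n \<delta> \<omega> \<partial>Pc n) = \<tau>bar n \<delta>" if "0 \<le> \<delta>" for n \<delta>
  proof -
    have "(\<integral>\<^sup>+\<omega>. (\<Sum>i=1..n. tau \<Theta> (M' n i) \<theta> \<delta> (X n i \<omega>)) / ennreal \<bar>J n\<bar> \<partial>P n) =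
        (\<integral>\<^sup>+\<omega>. (\<Sum>i=1..n. tau \<Theta> (M' n i) \<theta> \<delta> (X n i \<omega>)) \<partial>P n) / ennreal \<bar>J n\<bar>"
      by (rule nn_integral_divide, rule borel_measurable_sum, rule tau_meas[OF _ that])
    also have "(\<integral>\<^sup>+\<omega>. (\<Sum>i=1..n. tau \<Theta> (M' n i) \<theta> \<delta> (X n i \<omega>)) \<partial>P n) =
        (\<Sum>i=1..n. \<integral>\<^sup>+\<omega>. tau \<Theta> (M' n i) \<theta> \<delta> (X n i \<omega>) \<partial>P n)"
      by (rule nn_integral_sum, rule tau_meas[OF _ that])
    finally show ?thesis
      by (simp add: V_def \<tau>bar_def tau_bar_def J_def Pc_def nn_integral_completion)
  qed
  have rem_le: "ennreal (rem n h \<omega> / \<bar>J n\<bar>) \<le> ennreal \<bar>h\<bar> * V n \<bar>h\<bar> \<omega>"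
    if "reg n \<omega>" "{\<theta> - \<bar>h\<bar>..\<theta> + \<bar>h\<bar>} \<subseteq> \<Theta>" "J n \<noteq> 0" for n h \<omega>
    unfolding rem_def V_def using that by (intro sum_tau_remainder) (auto simp: reg_def)
  have rem_nonneg: "0 \<le> rem n h \<omega>" for n h \<omega>
    unfolding rem_def by (intro sum_nonneg) auto

  \<comment> \<open>Negligible remainder at the preliminary estimator\<close>
  have WD: "((\<lambda>z. ennreal (R (fst z) * \<bar>D z\<bar>) * V (fst z) \<bar>D z\<bar> (snd z)) \<longlongrightarrow> 0) F"
    unfolding F_def
  \<comment> \<open>With the factor \<open>R n * \<delta>\<close> included, the mean at
    \<open>\<delta> = \<bar>D z\<bar>\<close> is exactly the quantity in (d).\<close>
  proof (rule tendsto_0_at_random_point[where W = "\<lambda>n \<delta> \<omega>. ennreal (R n * \<delta>) * V n \<delta> \<omega>", OF Pc_prob])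
    show "(\<lambda>\<omega>. ennreal (R n * \<delta>) * V n \<delta> \<omega>) \<in> borel_measurable (Pc n)" if "0 \<le> \<delta>" for n \<delta>
      using V_meas[OF that, measurable] by measurable
    show "ennreal (R n * \<delta>) * V n \<delta> \<omega> \<le> ennreal (R n * \<delta>') * V n \<delta>' \<omega>" if "0 \<le> \<delta>" "\<delta> \<le> \<delta>'" for n \<delta> \<delta>' \<omega>
    \<comment> \<open>\<open>sqrt\<close> is odd, so \<open>R n\<close> could formally be negative;
      \<open>ennreal\<close> then truncates the factor to 0 and the inequality is trivial.\<close>
    proof (cases "R n \<ge> 0")
      case True
      with that show ?thesis by (intro mult_mono V_mono ennreal_leI mult_left_mono) auto
    next
      case False
      with that have "R n * \<delta> \<le> 0" by (simp add: mult_nonpos_nonneg)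
      then show ?thesis by (simp add: ennreal_neg)
    qed
    have "(\<integral>\<^sup>+\<omega>. ennreal (R n * \<delta>) * V n \<delta> \<omega> \<partial>Pc n) = ennreal (R n * \<delta>) * \<tau>bar n \<delta>"
      if "0 \<le> \<delta>" for n \<delta>
      using V_meas[OF that] V_int[OF that] by (simp add: nn_integral_cmult)
    then show "((\<lambda>z. \<integral>\<^sup>+\<omega>. ennreal (R (fst z) * \<bar>D z\<bar>) * V (fst z) \<bar>D z\<bar> \<omega> \<partial>Pc (fst z)) \<longlongrightarrow> 0) (prob_filter Pc)"
      using conv_in_prob_0_imp_tendsto[OF conv_in_prob_0_completion[OF d]]
      by (simp add: R_def D_def Pc_def)
  qed simp
  \<comment> \<open>Condition (d) forces \<open>\<theta>s\<close> into \<open>\<Theta>\<close>: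
    where the interval leaves \<open>\<Theta>\<close>, \<open>tau\<close> is infinite and so is the
    quantity in \<open>WD\<close>.\<close>
  have D_sub: "\<forall>\<^sub>F z in F. {\<theta> - \<bar>D z\<bar>..\<theta> + \<bar>D z\<bar>} \<subseteq> \<Theta>"
    using order_tendstoD(2)[OF WD, of 1, OF zero_less_one] pos
  proof eventually_elim
    case (elim z)
    show ?case
    proof (rule ccontr)
      assume not: "\<not> {\<theta> - \<bar>D z\<bar>..\<theta> + \<bar>D z\<bar>} \<subseteq> \<Theta>"
      then have "D z \<noteq> 0" using Theta(2) by auto
      then have "R (fst z) * \<bar>D z\<bar> > 0" using elim by (simp add: R_def)
      \<comment> \<open>An empty row would make \<open>V\<close> an empty sum; it is excluded
        because \<open>J\<close> vanishes at \<open>n = 0\<close>.\<close>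
      moreover have "{1..fst z} \<noteq> {}"
        using elim by (cases "fst z = 0") (auto simp: J_def J_sum_def)
      then have "V (fst z) \<bar>D z\<bar> (snd z) = \<top>"
        using not by (simp add: V_def tau_def ennreal_top_divide)
      ultimately show False using elim by (auto simp: ennreal_mult_top split: if_splits)
    qed
  qed
  have remD: "((\<lambda>z. rem (fst z) (D z) (snd z) / sqrt (I (fst z))) \<longlongrightarrow> 0) F"
  proof (rule tendsto_ennrealD)
    show "((\<lambda>z. ennreal (rem (fst z) (D z) (snd z) / sqrt (I (fst z)))) \<longlongrightarrow> ennreal 0) F"
    proof (rule tendsto_sandwich[of "\<lambda>_. 0"])
      show "\<forall>\<^sub>F z in F. ennreal (rem (fst z) (D z) (snd z) / sqrt (I (fst z)))
          \<le> ennreal (R (fst z) * \<bar>D z\<bar>) * V (fst z) \<bar>D z\<bar> (snd z)"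
        using reg pos D_sub
      proof eventually_elim
        case (elim z)
        have "rem (fst z) (D z) (snd z) / sqrt (I (fst z)) = R (fst z) * (rem (fst z) (D z) (snd z) / \<bar>J (fst z)\<bar>)"
          using elim by (simp add: R_def)
        moreover have R: "R (fst z) \<ge> 0" using elim by (simp add: R_def)
        ultimately have "ennreal (rem (fst z) (D z) (snd z) / sqrt (I (fst z))) =
            ennreal (R (fst z)) * ennreal (rem (fst z) (D z) (snd z) / \<bar>J (fst z)\<bar>)"
          by (simp add: rem_nonneg flip: ennreal_mult)
        also have "\<dots> \<le> ennreal (R (fst z)) * (ennreal \<bar>D z\<bar> * V (fst z) \<bar>D z\<bar> (snd z))"
          using elim by (intro mult_left_mono rem_le) auto
        also have "\<dots> = ennreal (R (fst z) * \<bar>D z\<bar>) * V (fst z) \<bar>D z\<bar> (snd z)"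
          using R by (simp add: ennreal_mult mult.assoc)
        finally show ?case .
      qed
    qed (use WD in auto)
    show "\<forall>\<^sub>F z in F. 0 \<le> rem (fst z) (D z) (snd z) / sqrt (I (fst z))"
      using pos by eventually_elim (simp add: rem_nonneg)
  qed simp

  \<comment> \<open>The one-step estimator is defined with probability tending to one\<close>
  have ratio: "((\<lambda>z. Js (fst z) (snd z) / J (fst z)) \<longlongrightarrow> 1) F"
    using conv_in_prob_imp_tendsto[OF conv_in_prob_completion[OF e_cons]] by (simp add: F_def Pc_def)
  have Js_nz: "\<forall>\<^sub>F z in F. Js (fst z) (snd z) \<noteq> 0"
    using order_tendstoD(1)[OF ratio zero_less_one] by eventually_elim auto
  have osd: "\<forall>\<^sub>F z in F. \<theta>s (fst z) (snd z) \<in> \<Theta> \<and> Js (fst z) (snd z) \<noteq> 0"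
    using D_sub Js_nz
  proof eventually_elim
    case (elim z)
    have "\<theta>s (fst z) (snd z) \<in> {\<theta> - \<bar>D z\<bar>..\<theta> + \<bar>D z\<bar>}" by (auto simp: D_def)
    with elim show ?case by blast
  qed
  have 1: "defined_wpt1 Pc (\<lambda>n \<omega>. one_step_defined \<Theta> Tstar Jstar n (sample X n \<omega>))"
    by (rule defined_wpt1I[OF Pc_prob]) (use osd in \<open>simp_all add: osd_iff F_def\<close>)

  \<comment> \<open>Asymptotic normality of the one-step estimator\<close>
  define U where "U n \<omega> = J n / sqrt (I n) * (\<theta>ss n \<omega> - \<theta>)" for n \<omega>
  define E where "E z = \<theta>ss (fst z) (snd z) - \<theta>" for z :: "nat \<times> 'w"
  have U_meas[measurable]: "U n \<in> borel_measurable (Pc n)" for n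
    unfolding U_def[abs_def] by measurable
  have Z_dist: "conv_in_dist Pc Z std_normal_distribution"
    using conv_in_dist_completion[OF b_clt] by (simp add: Z_def[abs_def] Pc_def)
  have Z_bdd: "bounded_in_prob Pc Z"
    using conv_in_dist_imp_bounded_in_prob[OF Pc_prob real_dist_normal_dist Z_dist] .
  \<comment> \<open>\<open>a\<close> measures the mismatch between \<open>Js\<close> and the sum of
    derivatives, and is bounded through (e) by inserting 1; \<open>b\<close> is the normalised
    expansion remainder. The products of \<open>D z\<close> with that sum cancel in
    \<open>a z - b z\<close>.\<close>
  define a where "a z = J (fst z) / sqrt (I (fst z)) * D z *
    (Js (fst z) (snd z) / J (fst z) - (\<Sum>i=1..fst z. M' (fst z) i \<theta> (X (fst z) i (snd z))) / J (fst z))" for z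
  define b where "b z = (\<Sum>i=1..fst z. M (fst z) i (\<theta> + D z) (X (fst z) i (snd z)) -
    M (fst z) i \<theta> (X (fst z) i (snd z)) - D z * M' (fst z) i \<theta> (X (fst z) i (snd z))) / sqrt (I (fst z))" for z
  have a: "(a \<longlongrightarrow> 0) F"
  proof (rule tendsto_0_sandwich_abs)
    show "((\<lambda>z. R (fst z) * \<bar>D z\<bar> * (\<bar>Js (fst z) (snd z) / J (fst z) - 1\<bar> +
        \<bar>(\<Sum>i=1..fst z. M' (fst z) i \<theta> (X (fst z) i (snd z))) / J (fst z) - 1\<bar>)) \<longlongrightarrow> 0) F"
      using conv_in_prob_imp_tendsto[OF conv_in_prob_completion[OF e_rate]]
      by (simp add: F_def Pc_def R_def D_def)
    show "\<forall>\<^sub>F z in F. \<bar>a z\<bar> \<le> R (fst z) * \<bar>D z\<bar> * (\<bar>Js (fst z) (snd z) / J (fst z) - 1\<bar> +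
        \<bar>(\<Sum>i=1..fst z. M' (fst z) i \<theta> (X (fst z) i (snd z))) / J (fst z) - 1\<bar>)"
      using pos
    proof eventually_elim
      case (elim z)
      then have "\<bar>a z\<bar> = R (fst z) * \<bar>D z\<bar> * \<bar>Js (fst z) (snd z) / J (fst z) -
          (\<Sum>i=1..fst z. M' (fst z) i \<theta> (X (fst z) i (snd z))) / J (fst z)\<bar>"
        by (simp add: a_def R_def abs_mult)
      also have "\<dots> \<le> R (fst z) * \<bar>D z\<bar> * (\<bar>Js (fst z) (snd z) / J (fst z) - 1\<bar> +
          \<bar>(\<Sum>i=1..fst z. M' (fst z) i \<theta> (X (fst z) i (snd z))) / J (fst z) - 1\<bar>)"
        using elim by (intro mult_left_mono) (auto simp: R_def)
      finally show ?case .
    qed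
  qed
  have b: "(b \<longlongrightarrow> 0) F"
  proof (rule tendsto_0_sandwich_abs[OF remD])
    show "\<forall>\<^sub>F z in F. \<bar>b z\<bar> \<le> rem (fst z) (D z) (snd z) / sqrt (I (fst z))"
      using pos by eventually_elim
        (simp add: b_def rem_def abs_divide divide_right_mono sum_abs)
  qed
  have inv_ratio: "((\<lambda>z. J (fst z) / Js (fst z) (snd z)) \<longlongrightarrow> 1) F"
    using tendsto_inverse[OF ratio] by simp
  \<comment> \<open>An exact identity where all quotients are defined: up to terms tending to 0,
    \<open>U\<close> is the negated score \<open>- Z\<close>.\<close>
  have U_eq: "\<forall>\<^sub>F z in F. J (fst z) / Js (fst z) (snd z) * (a z - b z) +
      (1 - J (fst z) / Js (fst z) (snd z)) * Z (fst z) (snd z) = U (fst z) (snd z) - (- Z (fst z) (snd z))"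
    using pos osd
  proof eventually_elim
    case (elim z)
    obtain n \<omega> where z: "z = (n, \<omega>)" by force
    define s where "s = sqrt (I n)"
    define S0 S1 S2 where "S0 = (\<Sum>i=1..n. M n i \<theta> (X n i \<omega>))"
      and "S1 = (\<Sum>i=1..n. M' n i \<theta> (X n i \<omega>))"
      and "S2 = (\<Sum>i=1..n. M n i (\<theta>s n \<omega>) (X n i \<omega>))"
    have bz: "b (n, \<omega>) = (S2 - S0 - D (n, \<omega>) * S1) / s"
      by (simp add: z b_def s_def S0_def S1_def S2_def sum_subtractf sum_distrib_left D_def)
    have az: "a (n, \<omega>) = J n / s * D (n, \<omega>) * (Js n \<omega> / J n - S1 / J n)" by (simp add: a_def s_def S1_def)
    have Uz: "U n \<omega> = J n / s * (D (n, \<omega>) - S2 / Js n \<omega>)"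
      using elim by (simp add: z U_def \<theta>ss_eq s_def S2_def D_def)
    have Zz: "Z n \<omega> = S0 / s" by (simp add: Z_def S0_def s_def)
    have "s \<noteq> 0" "J n \<noteq> 0" "Js n \<omega> \<noteq> 0" using elim by (auto simp: z s_def)
    then show ?case unfolding z fst_conv snd_conv az bz Uz Zz by (simp add: field_simps)
  qed
  have "((\<lambda>z. J (fst z) / Js (fst z) (snd z) * (a z - b z) +
      (1 - J (fst z) / Js (fst z) (snd z)) * Z (fst z) (snd z)) \<longlongrightarrow> 1 * (0 - 0) + 0) F"
  proof (rule tendsto_add[OF tendsto_mult[OF inv_ratio tendsto_diff[OF a b]]])
    have "((\<lambda>z. 1 - J (fst z) / Js (fst z) (snd z)) \<longlongrightarrow> 1 - 1) F"
      by (intro tendsto_diff tendsto_const inv_ratio)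
    then show "((\<lambda>z. (1 - J (fst z) / Js (fst z) (snd z)) * Z (fst z) (snd z)) \<longlongrightarrow> 0) F"
      unfolding F_def diff_self by (rule tendsto_0_mult_bounded_in_prob[OF Z_bdd])
  qed
  then have "((\<lambda>z. U (fst z) (snd z) - (- Z (fst z) (snd z))) \<longlongrightarrow> 0) F"
    using U_eq by (simp add: filterlim_cong[OF refl refl])
  then have U_dist: "conv_in_dist Pc U std_normal_distribution"
    unfolding F_def
    using conv_in_dist_converging_together[OF Pc_prob real_dist_normal_dist conv_in_dist_uminus_std_normal[OF Pc_prob Z_dist] U_meas] by blast
  then have 2: "conv_in_dist Pc (\<lambda>n \<omega>. J n / sqrt (I n) * (\<theta>ss n \<omega> - \<theta>)) std_normal_distribution"
    by (simp add: U_def[abs_def])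
  have U_bdd: "bounded_in_prob Pc U"
    using conv_in_dist_imp_bounded_in_prob[OF Pc_prob real_dist_normal_dist U_dist] .

  \<comment> \<open>Consistency of the one-step estimator and its expansion remainder\<close>
  have E: "(E \<longlongrightarrow> 0) F"
  proof -
    \<comment> \<open>\<open>\<bar>E z\<bar>\<close> is \<open>\<bar>U\<bar> / R\<close>, a tight
      quantity divided by one that diverges.\<close>
    have "((\<lambda>z. inverse (R (fst z))) \<longlongrightarrow> 0) F"
      unfolding F_def R_def
      by (rule tendsto_inverse_0_at_top[OF filterlim_compose[OF b_rate filterlim_fst_prob_filter]])
    then have "((\<lambda>z. inverse (R (fst z)) * \<bar>U (fst z) (snd z)\<bar>) \<longlongrightarrow> 0) F"
      unfolding F_def by (rule tendsto_0_mult_bounded_in_prob[OF bounded_in_prob_abs[OF U_bdd]])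
    moreover have "\<forall>\<^sub>F z in F. \<bar>E z\<bar> \<le> inverse (R (fst z)) * \<bar>U (fst z) (snd z)\<bar>"
      using pos by eventually_elim (simp add: U_def E_def R_def abs_mult)
    ultimately show ?thesis by (rule tendsto_0_sandwich_abs)
  qed
  have E_sub: "\<forall>\<^sub>F z in F. {\<theta> - \<bar>E z\<bar>..\<theta> + \<bar>E z\<bar>} \<subseteq> \<Theta>"
  proof -
    obtain e where e: "e > 0" "cball \<theta> e \<subseteq> \<Theta>" using Theta open_contains_cball by blast
    from tendstoD[OF E e(1)] show ?thesis
    proof eventually_elim
      case (elim z)
      then have "{\<theta> - \<bar>E z\<bar>..\<theta> + \<bar>E z\<bar>} \<subseteq> cball \<theta> e" by (auto simp: dist_real_def)
      with e(2) show ?case by blast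
    qed
  qed
  have VE: "((\<lambda>z. V (fst z) \<bar>E z\<bar> (snd z)) \<longlongrightarrow> 0) F"
    unfolding F_def
  proof (rule tendsto_0_at_random_point[OF Pc_prob])
    show "((\<lambda>z. \<integral>\<^sup>+\<omega>. V (fst z) \<bar>E z\<bar> \<omega> \<partial>Pc (fst z)) \<longlongrightarrow> 0) (prob_filter Pc)"
    proof (rule order_tendstoI)
      fix c0 :: ennreal assume "c0 > 0"
      \<comment> \<open>For a fixed small \<open>\<delta>\<close>, (c) makes the mean of
        \<open>V\<close> eventually smaller than \<open>c0\<close>; consistency puts
        \<open>\<bar>E z\<bar>\<close> below this \<open>\<delta>\<close> with high probability, and
        monotonicity compares the two means.\<close>
      then have "\<forall>\<^sub>F \<delta> in at_right 0. limsup (\<lambda>n. \<tau>bar n \<delta>) < c0"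
        by (rule order_tendstoD[OF c])
      then obtain \<delta>0 where \<delta>0: "\<delta>0 > 0" "\<And>\<delta>. 0 < \<delta> \<Longrightarrow> \<delta> < \<delta>0 \<Longrightarrow> limsup (\<lambda>n. \<tau>bar n \<delta>) < c0"
        unfolding eventually_at_right_field by blast
      define \<delta> where "\<delta> = \<delta>0 / 2"
      have \<delta>: "\<delta> > 0" "limsup (\<lambda>n. \<tau>bar n \<delta>) < c0" using \<delta>0 by (auto simp: \<delta>_def)
      have "\<forall>\<^sub>F z in F. \<tau>bar (fst z) \<delta> < c0"
        unfolding F_def by (rule eventually_prob_filterI_fst[OF Limsup_lessD[OF \<delta>(2)]])
      with tendstoD[OF E \<delta>(1)]
      show "\<forall>\<^sub>F z in prob_filter Pc. (\<integral>\<^sup>+\<omega>. V (fst z) \<bar>E z\<bar> \<omega> \<partial>Pc (fst z)) < c0"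
        unfolding F_def[symmetric]
      proof eventually_elim
        case (elim z)
        have "(\<integral>\<^sup>+\<omega>. V (fst z) \<bar>E z\<bar> \<omega> \<partial>Pc (fst z)) \<le> (\<integral>\<^sup>+\<omega>. V (fst z) \<delta> \<omega> \<partial>Pc (fst z))"
          using elim by (intro nn_integral_mono V_mono) (simp add: dist_real_def)
        with elim \<delta> show ?case by (simp add: V_int)
      qed
    qed simp
  qed (use V_meas V_mono in auto)
  \<comment> \<open>Unlike for \<open>D\<close>, the product of \<open>R\<close> and
    \<open>\<bar>E z\<bar>\<close> is \<open>\<bar>U\<bar>\<close>, hence tight, so convergence of
    \<open>V\<close> to 0 suffices and no analogue of (d) enters.\<close>
  have remE: "((\<lambda>z. rem (fst z) (E z) (snd z) / sqrt (I (fst z))) \<longlongrightarrow> 0) F"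
  proof (rule tendsto_0_sandwich_abs)
    have "((\<lambda>z. enn2real (V (fst z) \<bar>E z\<bar> (snd z))) \<longlongrightarrow> 0) F"
      using VE by (intro tendsto_enn2real) auto
    then show "((\<lambda>z. enn2real (V (fst z) \<bar>E z\<bar> (snd z)) * \<bar>U (fst z) (snd z)\<bar>) \<longlongrightarrow> 0) F"
      unfolding F_def by (rule tendsto_0_mult_bounded_in_prob[OF bounded_in_prob_abs[OF U_bdd]])
    show "\<forall>\<^sub>F z in F. \<bar>rem (fst z) (E z) (snd z) / sqrt (I (fst z))\<bar>
        \<le> enn2real (V (fst z) \<bar>E z\<bar> (snd z)) * \<bar>U (fst z) (snd z)\<bar>"
      using reg pos E_sub order_tendstoD(2)[OF VE, of 1, OF zero_less_one]
    proof eventually_elim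
      case (elim z)
      obtain v where v: "V (fst z) \<bar>E z\<bar> (snd z) = ennreal v" "v \<ge> 0"
        using elim by (cases "V (fst z) \<bar>E z\<bar> (snd z)") auto
      have "ennreal (rem (fst z) (E z) (snd z) / \<bar>J (fst z)\<bar>) \<le> ennreal (\<bar>E z\<bar> * v)"
        using rem_le[of "fst z" "snd z" "E z"] elim v by (simp add: ennreal_mult)
      then have "rem (fst z) (E z) (snd z) / \<bar>J (fst z)\<bar> \<le> \<bar>E z\<bar> * v" using v by simp
      then have "R (fst z) * (rem (fst z) (E z) (snd z) / \<bar>J (fst z)\<bar>) \<le> R (fst z) * (\<bar>E z\<bar> * v)"
        using elim by (intro mult_left_mono) (auto simp: R_def)
      then show ?case using elim v
        by (simp add: U_def E_def R_def abs_mult rem_nonneg mult_ac)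
    qed
  qed

  \<comment> \<open>Studentization\<close>
  have 3: "defined_wpt1 Pc (\<lambda>n \<omega>. d_stat_defined \<Theta> M Tstar Jstar n (sample X n \<omega>)) \<and>
      conv_in_dist Pc (\<lambda>n \<omega>. ds n \<omega> * (\<theta>ss n \<omega> - \<theta>)) std_normal_distribution"
    if M'_sq: "conv_in_prob P (\<lambda>n \<omega>. (\<Sum>i=1..n. (M' n i \<theta> (X n i \<omega>))\<^sup>2) / (J n)\<^sup>2) 0"
      and M_sq: "conv_in_prob P (\<lambda>n \<omega>. (\<Sum>i=1..n. (M n i \<theta> (X n i \<omega>))\<^sup>2) / I n) 1"
  proof -
    \<comment> \<open>Normalised Euclidean norms, to which \<open>L2_set_diff_le\<close> applies;
      after taking square roots, the two additional assumptions say that \<open>q \<theta>\<close>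
      tends to 1 and \<open>q'\<close> to 0.\<close>
    define q where "q t z = L2_set (\<lambda>i. M (fst z) i t (X (fst z) i (snd z))) {1..fst z} / sqrt (I (fst z))"
      for t z
    define q' where "q' z = L2_set (\<lambda>i. M' (fst z) i \<theta> (X (fst z) i (snd z))) {1..fst z} / \<bar>J (fst z)\<bar>" for z
    have q': "(q' \<longlongrightarrow> 0) F"
      using tendsto_real_sqrt[OF conv_in_prob_imp_tendsto[OF conv_in_prob_completion[OF M'_sq]]]
      by (simp add: F_def Pc_def q'_def[abs_def] L2_set_def real_sqrt_divide)
    have q: "(q \<theta> \<longlongrightarrow> 1) F"
      using tendsto_real_sqrt[OF conv_in_prob_imp_tendsto[OF conv_in_prob_completion[OF M_sq]]]
      by (simp add: F_def Pc_def q_def[abs_def] L2_set_def real_sqrt_divide)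
    have "((\<lambda>z. q (\<theta> + E z) z - q \<theta> z) \<longlongrightarrow> 0) F"
    proof (rule tendsto_0_sandwich_abs)
      have "((\<lambda>z. q' z * \<bar>U (fst z) (snd z)\<bar>) \<longlongrightarrow> 0) F"
        using q' unfolding F_def by (rule tendsto_0_mult_bounded_in_prob[OF bounded_in_prob_abs[OF U_bdd]])
      from tendsto_add[OF this remE]
      show "((\<lambda>z. q' z * \<bar>U (fst z) (snd z)\<bar> + rem (fst z) (E z) (snd z) / sqrt (I (fst z))) \<longlongrightarrow> 0) F"
        by simp
      \<comment> \<open>As \<open>U\<close> is \<open>J / sqrt I\<close> times \<open>E\<close>, the
        first-order term of the Minkowski bound, divided by \<open>sqrt I\<close>, equals
        \<open>q' z\<close> times \<open>\<bar>U\<bar>\<close>.\<close>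
      show "\<forall>\<^sub>F z in F. \<bar>q (\<theta> + E z) z - q \<theta> z\<bar> \<le>
          q' z * \<bar>U (fst z) (snd z)\<bar> + rem (fst z) (E z) (snd z) / sqrt (I (fst z))"
        using pos
      proof eventually_elim
        case (elim z)
        obtain n \<omega> where z: "z = (n, \<omega>)" by force
        let ?L = "\<lambda>f. L2_set (\<lambda>i. f i (X n i \<omega>)) {1..n}"
        have "q (\<theta> + E z) z - q \<theta> z = (?L (\<lambda>i. M n i (\<theta> + E z)) - ?L (\<lambda>i. M n i \<theta>)) / sqrt (I n)"
          by (simp add: q_def z diff_divide_distrib)
        also have "\<bar>\<dots>\<bar> = \<bar>?L (\<lambda>i. M n i (\<theta> + E z)) - ?L (\<lambda>i. M n i \<theta>)\<bar> / sqrt (I n)"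
          using elim by (simp add: z abs_divide)
        also have "\<dots> \<le> (\<bar>E z\<bar> * ?L (\<lambda>i. M' n i \<theta>) + rem n (E z) \<omega>) / sqrt (I n)"
          unfolding rem_def using elim by (intro divide_right_mono L2_set_diff_le) (simp add: z)
        also have "\<dots> = q' z * \<bar>U n \<omega>\<bar> + rem n (E z) \<omega> / sqrt (I n)"
          using elim by (simp add: q'_def U_def E_def z abs_mult add_divide_distrib)
        finally show ?case by (simp add: z)
      qed
    qed
    from tendsto_add[OF this q] have qE: "((\<lambda>z. q (\<theta> + E z) z) \<longlongrightarrow> 1) F" by simp

    \<comment> \<open>The value 0 outside \<open>\<Theta>\<close> makes \<open>m\<close> measurable
      by \<open>M_random\<close>; where \<open>d_stat\<close> is defined, it agrees with
      \<open>M n i\<close> at \<open>\<theta>ss\<close>.\<close>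
    define m where "m n i \<omega> = (if \<theta>ss n \<omega> \<in> \<Theta> then M n i (\<theta>ss n \<omega>) (X n i \<omega>) else 0)" for n i \<omega>
    have [measurable]: "(\<lambda>\<omega>. \<Sum>i=1..n. (m n i \<omega>)\<^sup>2) \<in> borel_measurable (Pc n)" for n
      unfolding m_def by (intro borel_measurable_sum borel_measurable_power M_random) auto
    have os_eq: "one_step \<Theta> M Tstar Jstar n (sample X n \<omega>) = \<theta>ss n \<omega>"
      and Js_eq: "Jstar n (sample X n \<omega>) = Js n \<omega>" for n \<omega>
      by (simp_all add: \<theta>ss_def Js_def)
    have dsd_iff: "d_stat_defined \<Theta> M Tstar Jstar n (sample X n \<omega>) \<longleftrightarrow>
        (\<theta>s n \<omega> \<in> \<Theta> \<and> Js n \<omega> \<noteq> 0) \<and> \<theta>ss n \<omega> \<in> \<Theta> \<and> (\<Sum>i=1..n. (m n i \<omega>)\<^sup>2) \<noteq> 0" for n \<omega>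
      by (cases "\<theta>ss n \<omega> \<in> \<Theta>")
        (simp_all add: d_stat_defined_def osd_iff os_eq m_def sum_sample[of "\<lambda>i x. (M n i (\<theta>ss n \<omega>) x)\<^sup>2" n \<omega>, simplified])
    have ds_eq: "ds n \<omega> = (if (\<theta>s n \<omega> \<in> \<Theta> \<and> Js n \<omega> \<noteq> 0) \<and> \<theta>ss n \<omega> \<in> \<Theta> \<and> (\<Sum>i=1..n. (m n i \<omega>)\<^sup>2) \<noteq> 0
        then Js n \<omega> / sqrt (\<Sum>i=1..n. (m n i \<omega>)\<^sup>2) else 0)" for n \<omega>
      by (cases "\<theta>ss n \<omega> \<in> \<Theta>")
        (simp_all add: ds_def d_stat_def dsd_iff os_eq Js_eq m_def sum_sample[of "\<lambda>i x. (M n i (\<theta>ss n \<omega>) x)\<^sup>2" n \<omega>, simplified])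
    have ds_meas: "ds n \<in> borel_measurable (Pc n)" for n
      unfolding ds_eq[abs_def] by measurable
    \<comment> \<open>\<open>q\<close> at the one-step estimator tends to 1 and so is eventually
      positive, which keeps the denominator of \<open>ds\<close> away from 0.\<close>
    have dsd: "\<forall>\<^sub>F z in F. \<theta>ss (fst z) (snd z) \<in> \<Theta> \<and>
        sqrt (\<Sum>i=1..fst z. (m (fst z) i (snd z))\<^sup>2) = q (\<theta> + E z) z * sqrt (I (fst z)) \<and> q (\<theta> + E z) z > 0"
      using E_sub pos order_tendstoD(1)[OF qE zero_less_one]
    proof eventually_elim
      case (elim z)
      have "\<theta>ss (fst z) (snd z) \<in> {\<theta> - \<bar>E z\<bar>..\<theta> + \<bar>E z\<bar>}" by (auto simp: E_def)
      with elim(1) have "\<theta>ss (fst z) (snd z) \<in> \<Theta>" by blast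
      with elim show ?case by (simp add: q_def L2_set_def m_def E_def)
    qed
    have dsd': "\<forall>\<^sub>F z in F. (\<theta>s (fst z) (snd z) \<in> \<Theta> \<and> Js (fst z) (snd z) \<noteq> 0) \<and>
        \<theta>ss (fst z) (snd z) \<in> \<Theta> \<and> (\<Sum>i=1..fst z. (m (fst z) i (snd z))\<^sup>2) \<noteq> 0"
      using dsd osd pos by eventually_elim force
    have "defined_wpt1 Pc (\<lambda>n \<omega>. d_stat_defined \<Theta> M Tstar Jstar n (sample X n \<omega>))"
    proof (rule defined_wpt1I[OF Pc_prob], unfold dsd_iff)
      show "{\<omega> \<in> space (Pc n). (\<theta>s n \<omega> \<in> \<Theta> \<and> Js n \<omega> \<noteq> 0) \<and> \<theta>ss n \<omega> \<in> \<Theta> \<and> (\<Sum>i=1..n. (m n i \<omega>)\<^sup>2) \<noteq> 0}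
          \<in> sets (Pc n)" for n
        by measurable
    qed (use dsd' in \<open>simp add: F_def\<close>)
    moreover have "conv_in_dist Pc (\<lambda>n \<omega>. ds n \<omega> * (\<theta>ss n \<omega> - \<theta>)) std_normal_distribution"
    proof (rule conv_in_dist_converging_together[OF Pc_prob real_dist_normal_dist U_dist])
      show "(\<lambda>\<omega>. ds n \<omega> * (\<theta>ss n \<omega> - \<theta>)) \<in> borel_measurable (Pc n)" for n
        using ds_meas[of n] \<theta>ss[of n] by measurable
      \<comment> \<open>On the good event the studentized error is \<open>Js / J / q\<close> times
        \<open>U\<close>, so it differs from \<open>U\<close> by a vanishing factor times a tight
        variable.\<close>
      have "((\<lambda>z. Js (fst z) (snd z) / J (fst z) / q (\<theta> + E z) z - 1) \<longlongrightarrow> 1 / 1 - 1) F"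
        by (intro tendsto_intros ratio qE) simp
      then have "((\<lambda>z. (Js (fst z) (snd z) / J (fst z) / q (\<theta> + E z) z - 1) * U (fst z) (snd z)) \<longlongrightarrow> 0) F"
        unfolding F_def by (intro tendsto_0_mult_bounded_in_prob[OF U_bdd]) simp
      moreover have "\<forall>\<^sub>F z in F. (Js (fst z) (snd z) / J (fst z) / q (\<theta> + E z) z - 1) * U (fst z) (snd z) =
          ds (fst z) (snd z) * (\<theta>ss (fst z) (snd z) - \<theta>) - U (fst z) (snd z)"
        using dsd dsd' pos
      proof eventually_elim
        case (elim z)
        then show ?case by (simp add: ds_eq U_def field_simps)
      qed
      ultimately show "((\<lambda>z. ds (fst z) (snd z) * (\<theta>ss (fst z) (snd z) - \<theta>) - U (fst z) (snd z)) \<longlongrightarrow> 0) (prob_filter Pc)"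
        unfolding F_def by (simp add: filterlim_cong[OF refl refl])
    qed
    ultimately show ?thesis ..
  qed
  from 1 2 3 show ?thesis by blast
qed

end
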